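(* Let $n\geqslant 2$ and let $R$ be a field with $\mathrm{char}(R)\geqslant n$. If $c\in M_n(R)$ is minimal, then $S_n(c,R)$ is a Frobenius $R$-algebra.
   Context: $M_n(R)$ is the ring of $n\times n$ matrices over $R$, $\mathrm{char}(R)$ is the characteristic of $R$, and $S_n(c,R)=\{a\in M_n(R)\mid ac=ca\}$ is the centralizer algebra of $c$. A nonscalar matrix $c\in M_n(R)$ is called minimal if for every $a\in M_n(R)$ with $S_n(a,R)\subseteq S_n(c,R)$ it follows that $S_n(a,R)=S_n(c,R)$. An extension of unital associative algebras $A/B$ (a unital ring homomorphism $B\to A$) is a Frobenius extension if $A$ is finitely generated projective as a right $B$-module and $A\cong \mathrm{Hom}(A_B,B_B)$ as $B$-$A$-bimodules. For a field $R$, an $R$-algebra $A$ is called a Frobenius $R$-algebra if $A/R$ is a Frobenius extension. *)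

theory Defs
  imports
    "Jordan_Normal_Form.Matrix"
    "HOL-Algebra.Algebraic_Closure_Type"
begin

section \<open>Right modules and bimodules over arbitrary rings\<close>

text \<open>
  The \<open>module\<close> locale of HOL-Algebra is restricted to commutative rings of scalars, whereas a
  Frobenius extension involves one-sided modules over arbitrary rings.  As for the record
  \<open>module\<close> of HOL-Algebra, only \<open>carrier\<close>, \<open>add\<close>, \<open>zero\<close> and the actions are meaningful
  in the records below; the fields \<open>mult\<close> and \<open>one\<close> inherited from \<open>ring\<close> play no role.
\<close>

record ('b, 'm) rmodule = "'m ring" +
  ract :: "'m \<Rightarrow> 'b \<Rightarrow> 'm"  (infixl \<open>\<triangleleft>\<index>\<close> 70)

record ('c, 'b, 'm) bimodule = "('b, 'm) rmodule" +
  lact :: "'c \<Rightarrow> 'm \<Rightarrow> 'm"  (infixr \<open>\<triangleright>\<index>\<close> 70)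

locale right_module = B?: ring B + M?: abelian_group M
  for B :: "('b, 'x) ring_scheme" (structure)
    and M :: "('b, 'm, 'y) rmodule_scheme" (structure) +
  assumes ract_closed:
      "\<lbrakk>x \<in> carrier M; b \<in> carrier B\<rbrakk> \<Longrightarrow> x \<triangleleft>\<^bsub>M\<^esub> b \<in> carrier M"
    and ract_l_distr:
      "\<lbrakk>x \<in> carrier M; y \<in> carrier M; b \<in> carrier B\<rbrakk> \<Longrightarrow>
        (x \<oplus>\<^bsub>M\<^esub> y) \<triangleleft>\<^bsub>M\<^esub> b = x \<triangleleft>\<^bsub>M\<^esub> b \<oplus>\<^bsub>M\<^esub> y \<triangleleft>\<^bsub>M\<^esub> b"
    and ract_r_distr:
      "\<lbrakk>x \<in> carrier M; b \<in> carrier B; c \<in> carrier B\<rbrakk> \<Longrightarrow>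
        x \<triangleleft>\<^bsub>M\<^esub> (b \<oplus>\<^bsub>B\<^esub> c) = x \<triangleleft>\<^bsub>M\<^esub> b \<oplus>\<^bsub>M\<^esub> x \<triangleleft>\<^bsub>M\<^esub> c"
    and ract_assoc:
      "\<lbrakk>x \<in> carrier M; b \<in> carrier B; c \<in> carrier B\<rbrakk> \<Longrightarrow>
        x \<triangleleft>\<^bsub>M\<^esub> (b \<otimes>\<^bsub>B\<^esub> c) = (x \<triangleleft>\<^bsub>M\<^esub> b) \<triangleleft>\<^bsub>M\<^esub> c"
    and ract_one:
      "x \<in> carrier M \<Longrightarrow> x \<triangleleft>\<^bsub>M\<^esub> \<one>\<^bsub>B\<^esub> = x"

definition rsubmodule ::
  "'m set \<Rightarrow> ('b, 'x) ring_scheme \<Rightarrow> ('b, 'm, 'y) rmodule_scheme \<Rightarrow> bool" where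
  "rsubmodule N B M \<longleftrightarrow>
     subgroup N (add_monoid M) \<and>
     (\<forall>x\<in>N. \<forall>b\<in>carrier B. x \<triangleleft>\<^bsub>M\<^esub> b \<in> N)"

definition rmodule_hom ::
  "('b, 'x) ring_scheme \<Rightarrow> ('b, 'm, 'y) rmodule_scheme \<Rightarrow> ('b, 'k, 'z) rmodule_scheme
    \<Rightarrow> ('m \<Rightarrow> 'k) set" where
  "rmodule_hom B M N =
     {h \<in> carrier M \<rightarrow> carrier N.
        (\<forall>x\<in>carrier M. \<forall>y\<in>carrier M. h (x \<oplus>\<^bsub>M\<^esub> y) = h x \<oplus>\<^bsub>N\<^esub> h y) \<and>
        (\<forall>x\<in>carrier M. \<forall>b\<in>carrier B. h (x \<triangleleft>\<^bsub>M\<^esub> b) = h x \<triangleleft>\<^bsub>N\<^esub> b)}"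

definition rmodule_isomorphic ::
  "('b, 'x) ring_scheme \<Rightarrow> ('b, 'm, 'y) rmodule_scheme \<Rightarrow> ('b, 'k, 'z) rmodule_scheme
    \<Rightarrow> bool" where
  "rmodule_isomorphic B M N \<longleftrightarrow>
     (\<exists>h \<in> rmodule_hom B M N. bij_betw h (carrier M) (carrier N))"

definition bimodule_isomorphic ::
  "('c, 'w) ring_scheme \<Rightarrow> ('b, 'x) ring_scheme
    \<Rightarrow> ('c, 'b, 'm, 'y) bimodule_scheme \<Rightarrow> ('c, 'b, 'k, 'z) bimodule_scheme \<Rightarrow> bool" where
  "bimodule_isomorphic C B M N \<longleftrightarrow>
     (\<exists>h \<in> rmodule_hom B M N. bij_betw h (carrier M) (carrier N) \<and>
        (\<forall>c\<in>carrier C. \<forall>x\<in>carrier M. h (c \<triangleright>\<^bsub>M\<^esub> x) = c \<triangleright>\<^bsub>N\<^esub> h x))"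

section \<open>Finitely generated projective modules\<close>

definition finitely_generated ::
  "('b, 'x) ring_scheme \<Rightarrow> ('b, 'm, 'y) rmodule_scheme \<Rightarrow> bool" where
  "finitely_generated B M \<longleftrightarrow>
     (\<exists>S. finite S \<and> S \<subseteq> carrier M \<and>
        (\<forall>N. rsubmodule N B M \<and> S \<subseteq> N \<longrightarrow> N = carrier M))"

text \<open>The free right module \<open>B\<^bsup>(I)\<^esup>\<close> of finitely supported families of elements of \<open>B\<close>.\<close>

definition free_rmodule :: "('b, 'x) ring_scheme \<Rightarrow> 'i set \<Rightarrow> ('b, 'i \<Rightarrow> 'b) rmodule" where
  "free_rmodule B I =
     \<lparr>carrier = {v \<in> I \<rightarrow>\<^sub>E carrier B. finite {i \<in> I. v i \<noteq> \<zero>\<^bsub>B\<^esub>}},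
      mult = undefined,
      one = undefined,
      zero = (\<lambda>i\<in>I. \<zero>\<^bsub>B\<^esub>),
      add = (\<lambda>v w. \<lambda>i\<in>I. v i \<oplus>\<^bsub>B\<^esub> w i),
      ract = (\<lambda>v b. \<lambda>i\<in>I. v i \<otimes>\<^bsub>B\<^esub> b)\<rparr>"

text \<open>
  A module is projective if it is isomorphic to a direct summand \<open>K\<close> of a free module
  \<open>F = K \<oplus> L\<close>.  Taking the index set inside the type of the elements of \<open>M\<close> is no
  restriction: \<open>M\<close> is a quotient of the free module on its own carrier, and if \<open>M\<close> is
  a direct summand of any free module, then this quotient map splits.
\<close>

definition projective ::
  "('b, 'x) ring_scheme \<Rightarrow> ('b, 'm, 'y) rmodule_scheme \<Rightarrow> bool" where
  "projective B M \<longleftrightarrow>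
     right_module B M \<and>
     (\<exists>(I :: 'm set) K L.
        let F = free_rmodule B I in
          rsubmodule K B F \<and> rsubmodule L B F \<and>
          K \<inter> L = {\<zero>\<^bsub>F\<^esub>} \<and> K <+>\<^bsub>F\<^esub> L = carrier F \<and>
          rmodule_isomorphic B M (F\<lparr>carrier := K\<rparr>))"

section \<open>Frobenius extensions and Frobenius algebras\<close>

text \<open>\<open>A\<close> as a right \<open>B\<close>-module along a ring homomorphism \<open>f\<close> from \<open>B\<close> to \<open>A\<close>.\<close>

definition ext_rmodule ::
  "('a, 'y) ring_scheme \<Rightarrow> ('b \<Rightarrow> 'a) \<Rightarrow> ('b, 'a) rmodule" where
  "ext_rmodule A f =
     \<lparr>carrier = carrier A, mult = mult A, one = \<one>\<^bsub>A\<^esub>, zero = \<zero>\<^bsub>A\<^esub>, add = add A,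
      ract = (\<lambda>x b. x \<otimes>\<^bsub>A\<^esub> f b)\<rparr>"

text \<open>\<open>A\<close> as a \<open>B\<close>-\<open>A\<close>-bimodule.\<close>

definition ext_bimodule ::
  "('a, 'y) ring_scheme \<Rightarrow> ('b \<Rightarrow> 'a) \<Rightarrow> ('b, 'a, 'a) bimodule" where
  "ext_bimodule A f =
     \<lparr>carrier = carrier A, mult = mult A, one = \<one>\<^bsub>A\<^esub>, zero = \<zero>\<^bsub>A\<^esub>, add = add A,
      ract = (\<lambda>x a. x \<otimes>\<^bsub>A\<^esub> a),
      lact = (\<lambda>b x. f b \<otimes>\<^bsub>A\<^esub> x)\<rparr>"

text \<open>
  \<open>Hom(A\<^sub>B, B\<^sub>B)\<close> as a \<open>B\<close>-\<open>A\<close>-bimodule: \<open>(b h)(x) = b h(x)\<close> and \<open>(h a)(x) = h(a x)\<close>.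
  Homomorphisms are taken to be undefined outside the carrier of \<open>A\<close>, so that equality in HOL is
  equality of maps on \<open>A\<close>.
\<close>

definition dual_bimodule ::
  "('b, 'x) ring_scheme \<Rightarrow> ('a, 'y) ring_scheme \<Rightarrow> ('b \<Rightarrow> 'a)
    \<Rightarrow> ('b, 'a, 'a \<Rightarrow> 'b) bimodule" where
  "dual_bimodule B A f =
     \<lparr>carrier = rmodule_hom B (ext_rmodule A f) (ext_rmodule B (\<lambda>b. b)) \<inter>
        extensional (carrier A),
      mult = undefined,
      one = undefined,
      zero = (\<lambda>x\<in>carrier A. \<zero>\<^bsub>B\<^esub>),
      add = (\<lambda>g h. \<lambda>x\<in>carrier A. g x \<oplus>\<^bsub>B\<^esub> h x),
      ract = (\<lambda>h a. \<lambda>x\<in>carrier A. h (a \<otimes>\<^bsub>A\<^esub> x)),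
      lact = (\<lambda>b h. \<lambda>x\<in>carrier A. b \<otimes>\<^bsub>B\<^esub> h x)\<rparr>"

definition frobenius_extension ::
  "('b, 'x) ring_scheme \<Rightarrow> ('a, 'y) ring_scheme \<Rightarrow> ('b \<Rightarrow> 'a) \<Rightarrow> bool" where
  "frobenius_extension B A f \<longleftrightarrow>
     ring_hom_ring B A f \<and>
     finitely_generated B (ext_rmodule A f) \<and>
     projective B (ext_rmodule A f) \<and>
     bimodule_isomorphic B A (ext_bimodule A f) (dual_bimodule B A f)"

text \<open>The \<open>R\<close>-algebra structure of \<open>A\<close> is given by its structure map \<open>f\<close> from \<open>R\<close> to
  the centre of \<open>A\<close>.\<close>

definition frobenius_algebra ::
  "('r, 'x) ring_scheme \<Rightarrow> ('a, 'y) ring_scheme \<Rightarrow> ('r \<Rightarrow> 'a) \<Rightarrow> bool" where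
  "frobenius_algebra R A f \<longleftrightarrow>
     field R \<and>
     (\<forall>r\<in>carrier R. \<forall>x\<in>carrier A. f r \<otimes>\<^bsub>A\<^esub> x = x \<otimes>\<^bsub>A\<^esub> f r) \<and>
     frobenius_extension R A f"

section \<open>Centralizers and minimal matrices\<close>

definition centralizer_mat :: "nat \<Rightarrow> 'a::semiring_1 mat \<Rightarrow> 'a mat set" where
  "centralizer_mat n c = {a \<in> carrier_mat n n. a * c = c * a}"

definition centralizer_algebra :: "nat \<Rightarrow> 'a::semiring_1 mat \<Rightarrow> 'a mat ring" where
  "centralizer_algebra n c = (ring_mat TYPE('a) n ())\<lparr>carrier := centralizer_mat n c\<rparr>"

definition scalar_mat :: "nat \<Rightarrow> 'a::semiring_1 \<Rightarrow> 'a mat" where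
  "scalar_mat n r = r \<cdot>\<^sub>m 1\<^sub>m n"

definition minimal_mat :: "nat \<Rightarrow> 'a::semiring_1 mat \<Rightarrow> bool" where
  "minimal_mat n c \<longleftrightarrow>
     c \<in> carrier_mat n n \<and>
     c \<notin> range (scalar_mat n) \<and>
     (\<forall>a\<in>carrier_mat n n.
        centralizer_mat n a \<subseteq> centralizer_mat n c \<longrightarrow> centralizer_mat n a = centralizer_mat n c)"

end

theory Submission
  imports Defs "HOL-Library.Function_Algebras"
begin

text \<open>
  A minimal matrix \<open>c\<close> has a cyclic vector, and then its centralizer is \<open>R[c]\<close>, a
  quotient \<open>R[X]/(m)\<close> of the polynomial ring in one variable.  On such a quotient the coefficient of
  the highest power of \<open>X\<close> is a Frobenius form: its Gram matrix on the powers of \<open>X\<close> is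
  triangular with ones on the antidiagonal.

  For the existence of a cyclic vector, view the space of column vectors as a module over \<open>R[X]\<close>,
  with \<open>X\<close> acting as \<open>c\<close>.  Some vector \<open>v\<close> has the minimal polynomial \<open>m\<close> of \<open>c\<close> as its
  annihilator (\<open>ex_vector_with_minimal_polynomial\<close>), and \<open>R[c] v\<close> has an invariant
  complement, cut out by the functional \<open>\<phi>\<close> that extends the last coordinate on \<open>R[c] v\<close>.  Suppose
  that the complement is nonzero, and let \<open>e\<close> be the projection onto one of its nonzero primary
  parts, say for the irreducible polynomial \<open>f\<close>, which divides \<open>m\<close>.  The matrix \<open>c + s e\<close> has the
  eigenvalues of \<open>c\<close>, except that the roots of \<open>f\<close> have been moved by \<open>s\<close> on the image of \<open>e\<close>.  The
  degree of \<open>m\<close> is below \<open>n\<close> and so below the characteristic; hence some \<open>s\<close> in the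
  prime field moves a root of \<open>f\<close> off the roots of \<open>m\<close> (\<open>exists_shift_not_dvd\<close>).  For this \<open>s\<close> the matrix \<open>c\<close>
  is a polynomial in \<open>c + s e\<close> by the Chinese remainder theorem, so the centralizer of \<open>c + s e\<close> is
  contained in that of \<open>c\<close>.  It is strictly smaller, because \<open>e\<close> does not commute with the
  homomorphisms from \<open>R[c] v\<close> to the image of \<open>e\<close>, and one of those is nonzero.  This
  contradicts minimality (\<open>noncyclic_refinement\<close>, \<open>minimal_mat_imp_cyclic\<close>).

  The Frobenius property itself is deduced from dual bases
  (\<open>frobenius_form.frobenius_algebra\<close>, \<open>cyclic_imp_frobenius_algebra\<close>).
\<close>

section \<open>Bezout identities for polynomials over a field\<close>

lemma bezout_coprime:
  fixes f g :: "'a::field poly"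
  assumes only_units: "\<And>d. d dvd f \<Longrightarrow> d dvd g \<Longrightarrow> is_unit d" and "f \<noteq> 0"
  shows "\<exists>a b. a * f + b * g = 1"
proof -
  define I where "I = {r. \<exists>a b. r = a * f + b * g}"
  have f: "f \<in> I" unfolding I_def by (rule CollectI, rule exI[of _ 1], rule exI[of _ 0]) simp
  have g: "g \<in> I" unfolding I_def by (rule CollectI, rule exI[of _ 0], rule exI[of _ 1]) simp
  obtain d where d: "d \<in> I" "d \<noteq> 0"
    and least: "\<And>r. r \<in> I \<Longrightarrow> r \<noteq> 0 \<Longrightarrow> Polynomial.degree d \<le> Polynomial.degree r"
    using ex_has_least_nat[of "\<lambda>r. r \<in> I \<and> r \<noteq> 0" f Polynomial.degree] f \<open>f \<noteq> 0\<close> by blast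
  have dvd: "d dvd r" if rI: "r \<in> I" for r
  proof -
    obtain a b where r: "r = a * f + b * g" using rI unfolding I_def by blast
    obtain a' b' where d': "d = a' * f + b' * g" using d(1) unfolding I_def by blast
    have "r mod d = r - r div d * d" by (simp add: minus_div_mult_eq_mod)
    also have "\<dots> = (a * f + b * g) - r div d * (a' * f + b' * g)" by (simp only: r[symmetric] d'[symmetric])
    also have "\<dots> = (a - r div d * a') * f + (b - r div d * b') * g" by (simp add: algebra_simps)
    finally have "r mod d = (a - r div d * a') * f + (b - r div d * b') * g" .
    then have "r mod d \<in> I" unfolding I_def by blast
    then show ?thesis
      using least[of "r mod d"] degree_mod_less[OF \<open>d \<noteq> 0\<close>, of r]
      by (metis mod_eq_0_iff_dvd not_less)
  qed
  have "is_unit d" by (intro only_units dvd f g)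
  then obtain e where "e * d = 1" by (metis dvd_def mult.commute)
  moreover obtain a b where "d = a * f + b * g" using d(1) unfolding I_def by blast
  ultimately have "(e * a) * f + (e * b) * g = 1" by (simp add: algebra_simps)
  then show ?thesis by blast
qed

lemma bezout_irreducible_power:
  fixes f g :: "'a::field poly"
  assumes f: "Factorial_Ring.irreducible f" and "\<not> f dvd g"
  shows "\<exists>a b. a * f ^ k + b * g = 1"
proof (induction k)
  case 0
  have "1 * f ^ 0 + 0 * g = 1" by simp
  then show ?case by blast
next
  case (Suc k)
  then obtain a b where ab: "a * f ^ k + b * g = 1" by blast
  have "\<exists>a b. a * f + b * g = 1"
  proof (rule bezout_coprime)
    fix d assume "d dvd f" "d dvd g"
    then show "is_unit d"
      using irreducibleD'[OF f, of d] dvd_trans[of f d g] \<open>\<not> f dvd g\<close> by blast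
  qed (use f in auto)
  then obtain a' b' where ab': "a' * f + b' * g = 1" by blast
  have "(a' * a) * f ^ Suc k + (a' * f * b + b' * a * f ^ k + b' * b * g) * g
      = (a' * f + b' * g) * (a * f ^ k + b * g)"
    by (simp add: algebra_simps)
  then show ?case by (metis ab ab' mult_1)
qed

lemma irreducible_power_dvd_cancel:
  fixes f g h :: "'a::field poly"
  assumes "Factorial_Ring.irreducible f" "\<not> f dvd g" "f ^ k dvd g * h"
  shows "f ^ k dvd h"
proof -
  obtain a b where "a * f ^ k + b * g = 1" using bezout_irreducible_power[OF assms(1,2)] by blast
  then have "h = (a * f ^ k + b * g) * h" by simp
  also have "\<dots> = f ^ k * (a * h) + b * (g * h)" by (simp add: algebra_simps)
  finally have "h = f ^ k * (a * h) + b * (g * h)" .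
  then show ?thesis using assms(3) by (metis dvd_add dvd_triv_left dvd_mult)
qed

lemma factor_out_power:
  fixes f m :: "'a::field poly"
  assumes f: "Factorial_Ring.irreducible f" and "m \<noteq> 0"
  shows "\<exists>j h. m = f ^ j * h \<and> \<not> f dvd h"
  using \<open>m \<noteq> 0\<close>
proof (induction "Polynomial.degree m" arbitrary: m rule: less_induct)
  case less
  show ?case
  proof (cases "f dvd m")
    case False
    then have "m = f ^ 0 * m \<and> \<not> f dvd m" by simp
    then show ?thesis by blast
  next
    case True
    then obtain q where q: "m = f * q" by blast
    have "Polynomial.degree f > 0"
      using f by (auto simp: Factorial_Ring.irreducible_def is_unit_iff_degree)
    then have "Polynomial.degree q < Polynomial.degree m"
      using less.prems q by (auto simp: Polynomial.degree_mult_eq)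
    then obtain j h where "q = f ^ j * h" "\<not> f dvd h" using less q by fastforce
    then have "m = f ^ Suc j * h \<and> \<not> f dvd h" using q by (simp add: mult.assoc)
    then show ?thesis by blast
  qed
qed

text \<open>
  Substituting \<open>X - s\<close> is an automorphism of the polynomial ring.
\<close>

lemma irreducible_shift:
  fixes f :: "'a::field poly"
  assumes f: "Factorial_Ring.irreducible f"
  shows "Factorial_Ring.irreducible (pcompose f [:- s, 1:])"
proof (rule Factorial_Ring.irreducibleI)
  have inv: "pcompose (pcompose p [:- t, 1:]) [:t, 1:] = p" for p :: "'a poly" and t
    by (simp add: pcompose_assoc[symmetric] pcompose_pCons)
  have unit_shift: "is_unit (pcompose p [:t, 1:])" if p: "is_unit p" for p :: "'a poly" and t
  proof -
    obtain q where "1 = p * q" using p by blast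
    moreover have "pcompose 1 [:t, 1:] = (1 :: 'a poly)" by (simp add: one_pCons)
    ultimately have "1 = pcompose p [:t, 1:] * pcompose q [:t, 1:]" by (simp flip: pcompose_mult)
    then show ?thesis by (rule dvdI)
  qed
  show "pcompose f [:- s, 1:] \<noteq> 0"
  proof
    assume "pcompose f [:- s, 1:] = 0"
    then have "f = 0" using inv[of f s] by simp
    then show False using f by simp
  qed
  show "\<not> is_unit (pcompose f [:- s, 1:])"
    using unit_shift[of "pcompose f [:- s, 1:]" s] f irreducible_not_unit by (auto simp: inv)
  fix a b assume ab: "pcompose f [:- s, 1:] = a * b"
  have "f = pcompose a [:s, 1:] * pcompose b [:s, 1:]"
    using inv[of f s] by (simp add: ab pcompose_mult)
  then have "is_unit (pcompose a [:s, 1:]) \<or> is_unit (pcompose b [:s, 1:])"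
    by (rule Factorial_Ring.irreducibleD[OF f])
  moreover have "pcompose (pcompose p [:s, 1:]) [:- s, 1:] = p" for p using inv[of p "- s"] by simp
  ultimately show "is_unit a \<or> is_unit b" by (metis unit_shift)
qed

text \<open>
  This is the only place where the characteristic enters.  Fix a root \<open>\<alpha>\<close> of \<open>f\<close> in the algebraic
  closure.  If \<open>f (X - k)\<close> divided \<open>m\<close> for each \<open>k\<close> in the prime field, then all the elements
  \<open>\<alpha> + k\<close> would be roots of \<open>m\<close>, and there are \<open>CHAR('a)\<close> of them, more than \<open>m\<close> can have.  Counting
  translates of a single root, rather than pairs of roots of \<open>f\<close> and \<open>m\<close>, is what makes a bound on
  \<open>CHAR('a)\<close> that is linear in the degree sufficient.
\<close>

lemma exists_shift_not_dvd:
  fixes f m :: "'a::field poly"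
  assumes f: "Polynomial.degree f > 0" and m: "m \<noteq> 0" "Polynomial.degree m < CHAR('a)"
  shows "\<exists>s. \<not> pcompose f [:- s, 1:] dvd m"
proof (rule ccontr)
  assume "\<not> ?thesis"
  then have all: "pcompose f [:- s, 1:] dvd m" for s by blast
  define em where "em = map_poly (to_ac :: 'a \<Rightarrow> 'a alg_closure)"
  have hom: "em (p * q) = em p * em q" for p q
    by (intro poly_eqI) (simp add: em_def coeff_map_poly coeff_mult to_ac_sum)
  have poly_em: "poly (em p) (to_ac x + y) = poly (em (pcompose p [:x, 1:])) y" for p x y
  proof (induction p)
    case (pCons a p)
    have e: "em (p + q) = em p + em q" for p q
      by (intro poly_eqI) (simp add: em_def coeff_map_poly)
    have c: "em (pCons a p) = pCons (to_ac a) (em p)" for a p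
      by (simp add: em_def map_poly_pCons)
    have "em [:a:] = [:to_ac a:]" for a using c[of a 0] by (simp add: em_def)
    then show ?case using pCons
      by (simp add: pcompose_pCons e hom c algebra_simps del: mult_pCons_left)
  qed (simp add: em_def)
  have deg: "Polynomial.degree (em p) = Polynomial.degree p" for p
    unfolding em_def by (rule degree_map_poly) simp
  obtain \<alpha> where \<alpha>: "poly (em f) \<alpha> = 0"
    using alg_closed_imp_poly_has_root[of "em f"] f deg by metis
  have "poly (em m) (of_nat k + \<alpha>) = 0" for k
  proof -
    obtain q where q: "m = pcompose f [:- of_nat k, 1:] * q" using all[of "of_nat k"] by blast
    have "poly (em (pcompose f [:- of_nat k, 1:])) (of_nat k + \<alpha>) = 0"
      using poly_em[of f "- of_nat k" "of_nat k + \<alpha>"] \<alpha> by simp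
    then show ?thesis using q hom by simp
  qed
  then have "(\<lambda>k. of_nat k + \<alpha>) ` {..<CHAR('a)} \<subseteq> {x. poly (em m) x = 0}" by auto
  moreover have "em m \<noteq> 0" using m by (auto simp: em_def map_poly_eq_0_iff)
  moreover have "inj_on (\<lambda>k. of_nat k + \<alpha>) {..<CHAR('a)}"
  proof (rule inj_onI)
    fix i j assume ij: "i \<in> {..<CHAR('a)}" "j \<in> {..<CHAR('a)}" "of_nat i + \<alpha> = of_nat j + \<alpha>"
    have le: "l \<le> k" if kl: "k < CHAR('a)" "l < CHAR('a)" "(of_nat k :: 'a alg_closure) = of_nat l" for k l
    proof (rule ccontr)
      assume "\<not> l \<le> k"
      then have "(of_nat (l - k) :: 'a alg_closure) = 0" using kl by (simp add: of_nat_diff)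
      then have "CHAR('a) dvd l - k" by (simp add: of_nat_eq_0_iff_char_dvd)
      then show False using \<open>\<not> l \<le> k\<close> kl by (auto dest: dvd_imp_le)
    qed
    show "i = j" using ij le[of i j] le[of j i] by simp
  qed
  ultimately have "CHAR('a) \<le> card {x. poly (em m) x = 0}"
    by (metis card_image card_lessThan card_mono poly_roots_finite)
  also have "\<dots> \<le> Polynomial.degree m"
    using card_poly_roots_bound[OF \<open>em m \<noteq> 0\<close>] deg by simp
  finally show False using m by simp
qed

section \<open>Polynomials acting on vectors\<close>

definition (in vector_space) poly_act :: "('b \<Rightarrow> 'b) \<Rightarrow> 'a poly \<Rightarrow> 'b \<Rightarrow> 'b" where
  "poly_act T p x = (\<Sum>i\<le>Polynomial.degree p. Polynomial.coeff p i *s (T ^^ i) x)"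

locale linear_operator = vector_space scale
  for scale :: "'a::field \<Rightarrow> 'v::ab_group_add \<Rightarrow> 'v"  (infixr \<open>*s\<close> 75) +
  fixes T :: "'v \<Rightarrow> 'v"
  assumes T_add: "T (x + y) = T x + T y"
    and T_scale: "T (r *s x) = r *s T x"
begin

abbreviation act :: "'a poly \<Rightarrow> 'v \<Rightarrow> 'v" where
  "act \<equiv> poly_act T"

lemma T_0 [simp]: "T 0 = 0"
  using T_scale[of 0 0] by simp

lemma T_sum: "T (sum f A) = (\<Sum>i\<in>A. T (f i))"
  by (induction A rule: infinite_finite_induct) (simp_all add: T_add)

lemma funpow_T_add: "(T ^^ i) (x + y) = (T ^^ i) x + (T ^^ i) y"
  by (induction i) (simp_all add: T_add)

lemma funpow_T_scale: "(T ^^ i) (r *s x) = r *s (T ^^ i) x"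
  by (induction i) (simp_all add: T_scale)

lemma poly_act_eq_sum:
  assumes "Polynomial.degree p \<le> N"
  shows "act p x = (\<Sum>i\<le>N. Polynomial.coeff p i *s (T ^^ i) x)"
  unfolding poly_act_def using assms
  by (intro sum.mono_neutral_left) (auto intro: coeff_eq_0)

lemma act_0 [simp]: "act 0 x = 0"
  by (simp add: poly_act_def)

lemma act_pCons: "act (pCons a p) x = a *s x + T (act p x)"
proof -
  have "act (pCons a p) x
      = (\<Sum>i\<le>Suc (Polynomial.degree p). Polynomial.coeff (pCons a p) i *s (T ^^ i) x)"
    by (rule poly_act_eq_sum) (rule degree_pCons_le)
  also have "\<dots> = a *s x + (\<Sum>i\<le>Polynomial.degree p. Polynomial.coeff p i *s T ((T ^^ i) x))"
    by (subst sum.atMost_Suc_shift) simp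
  also have "\<dots> = a *s x + T (act p x)"
    by (simp add: poly_act_def T_sum T_scale)
  finally show ?thesis .
qed

lemma act_1 [simp]: "act 1 x = x"
  by (simp add: one_pCons act_pCons)

lemma act_add: "act (p + q) x = act p x + act q x"
proof (induction p arbitrary: q)
  case (pCons a p)
  obtain b r where q: "q = pCons b r" by (cases q)
  show ?case by (simp add: q act_pCons pCons.IH T_add scale_left_distrib add.assoc add.left_commute)
qed simp

lemma act_smult: "act (Polynomial.smult r p) x = r *s act p x"
  by (induction p) (simp_all add: act_pCons T_scale scale_right_distrib)

lemma act_minus: "act (- p) x = - act p x"
  using act_smult[of "- 1" p x] by simp

lemma act_diff: "act (p - q) x = act p x - act q x"
  using act_add[of p "- q" x] by (simp add: act_minus)

lemma act_mult: "act (p * q) x = act p (act q x)"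
  by (induction p) (simp_all add: act_pCons act_add act_smult)

lemma act_mult': "act (p * q) x = act q (act p x)"
  using act_mult[of q p x] by (simp add: mult.commute)

lemma act_monom: "act (Polynomial.monom r i) x = r *s (T ^^ i) x"
  by (induction i) (simp_all add: monom_0 monom_Suc act_pCons T_scale)

lemma act_X: "act [:0, 1:] x = T x"
  by (simp add: act_pCons)

lemma act_vec_add: "act p (x + y) = act p x + act p y"
  by (induction p) (simp_all add: act_pCons T_add scale_right_distrib)

lemma act_vec_scale: "act p (r *s x) = r *s act p x"
  by (induction p) (simp_all add: act_pCons T_scale scale_right_distrib scale_left_commute)

lemma act_vec_0 [simp]: "act p 0 = 0"
  using act_vec_scale[of p 0 0] by simp

lemma act_vec_diff: "act p (x - y) = act p x - act p y"
  using act_vec_add[of p "x - y" y] by (simp add: algebra_simps)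

lemma T_act: "T (act p x) = act p (T x)"
  using act_mult[of "[:0, 1:]" p x] act_mult[of p "[:0, 1:]" x]
  by (simp only: act_X mult.commute[of p])

lemma funpow_act: "(T ^^ i) (act p x) = act p ((T ^^ i) x)"
  by (induction i) (simp_all add: T_act)

lemma act_poly_sum: "act (\<Sum>i\<in>A. P i) x = (\<Sum>i\<in>A. act (P i) x)"
  by (induction A rule: infinite_finite_induct) (simp_all add: act_add)

text \<open>Replacing \<open>T\<close> by its translate \<open>T + s\<close> amounts to substituting \<open>X + s\<close> into polynomials.\<close>

lemma poly_act_translate: "poly_act (\<lambda>x. T x + s *s x) p x = act (pcompose p [:s, 1:]) x"
proof -
  interpret S: linear_operator scale "\<lambda>x. T x + s *s x"
    by unfold_locales (simp_all add: T_add T_scale scale_right_distrib scale_left_commute)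
  show ?thesis
  proof (induction p)
    case (pCons a p)
    let ?q = "pcompose p [:s, 1:]"
    have "act (pcompose (pCons a p) [:s, 1:]) x = act [:a:] x + act [:s, 1:] (act ?q x)"
      by (simp only: pcompose_pCons act_add act_mult)
    also have "\<dots> = a *s x + (s *s act ?q x + T (act ?q x))"
      by (simp add: act_pCons)
    finally show ?case using pCons by (simp add: S.act_pCons add.commute)
  qed simp
qed

text \<open>
  The polynomials that kill \<open>x\<close> form an ideal; \<open>p\<close> is a nonzero generator of it.  The degree of
  \<open>p\<close> is the dimension of the cyclic subspace generated by \<open>x\<close>.
\<close>

definition annihilator_gen :: "'a poly \<Rightarrow> 'v \<Rightarrow> bool" where
  "annihilator_gen p x \<longleftrightarrow> p \<noteq> 0 \<and> (\<forall>q. act q x = 0 \<longleftrightarrow> p dvd q)"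

lemma annihilator_gen_exists:
  assumes "q \<noteq> 0" "act q x = 0"
  shows "\<exists>p. annihilator_gen p x"
proof -
  obtain p where p: "p \<noteq> 0" "act p x = 0"
    and least: "\<And>r. r \<noteq> 0 \<Longrightarrow> act r x = 0 \<Longrightarrow> Polynomial.degree p \<le> Polynomial.degree r"
    using ex_has_least_nat[of "\<lambda>r. r \<noteq> 0 \<and> act r x = 0" q Polynomial.degree] assms by blast
  have "p dvd r" if r: "act r x = 0" for r
  proof -
    have "act r x = act (r div p * p + r mod p) x" by simp
    then have "act (r mod p) x = 0" using r p by (simp only: act_add act_mult) simp
    then show ?thesis
      using least[of "r mod p"] degree_mod_less[OF \<open>p \<noteq> 0\<close>, of r]
      by (metis mod_eq_0_iff_dvd not_less)
  qed
  moreover have "act r x = 0" if "p dvd r" for r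
    using that p by (auto simp: act_mult')
  ultimately show ?thesis using p unfolding annihilator_gen_def by blast
qed

text \<open>
  A linear dependency among \<open>x, T x, T\<^sup>2 x, \<dots>\<close> is the same thing as a polynomial killing \<open>x\<close>.
\<close>

lemma powers_independent:
  assumes nz: "\<And>q. q \<noteq> 0 \<Longrightarrow> Polynomial.degree q < k \<Longrightarrow> act q x \<noteq> 0"
  shows "inj_on (\<lambda>i. (T ^^ i) x) {..<k}" and "independent ((\<lambda>i. (T ^^ i) x) ` {..<k})"
proof -
  show inj: "inj_on (\<lambda>i. (T ^^ i) x) {..<k}"
  proof (rule inj_onI, rule ccontr)
    fix i j assume ij: "i \<in> {..<k}" "j \<in> {..<k}" "(T ^^ i) x = (T ^^ j) x" "i \<noteq> j"
    define q where "q = Polynomial.monom (1::'a) i - Polynomial.monom 1 j"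
    have "Polynomial.coeff q i = 1" using ij by (simp add: q_def)
    then have "q \<noteq> 0" by auto
    moreover have "Polynomial.degree q < k"
      unfolding q_def using ij by (intro degree_diff_less) (simp_all add: degree_monom_eq)
    moreover have "act q x = 0" using ij by (simp add: q_def act_diff act_monom)
    ultimately show False using nz by blast
  qed
  show "independent ((\<lambda>i. (T ^^ i) x) ` {..<k})"
  proof (rule independent_if_scalars_zero)
    fix g y assume sum: "(\<Sum>y\<in>(\<lambda>i. (T ^^ i) x) ` {..<k}. g y *s y) = 0"
      and y: "y \<in> (\<lambda>i. (T ^^ i) x) ` {..<k}"
    define q where "q = (\<Sum>i<k. Polynomial.monom (g ((T ^^ i) x)) i)"
    have coeff: "Polynomial.coeff q i = (if i < k then g ((T ^^ i) x) else 0)" for i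
      by (simp add: q_def coeff_sum)
    have "act q x = 0"
      using sum inj by (simp add: q_def act_poly_sum act_monom sum.reindex)
    moreover have "Polynomial.degree q < k" if "q \<noteq> 0"
      using that coeff[of "Polynomial.degree q"] leading_coeff_neq_0[OF that] by (auto split: if_splits)
    ultimately have "q = 0" using nz by blast
    then show "g y = 0" using y coeff by (metis (no_types, lifting) coeff_0 imageE lessThan_iff)
  qed simp
qed

end

text \<open>
  The bound on independent sets says that \<open>V\<close> has dimension at most \<open>n\<close>.  The subspace is kept
  separate from the ambient type because, for matrices, the dimension is a term and not a type.
\<close>

locale invariant_subspace = linear_operator +
  fixes V :: "'b set" and n :: nat
  assumes subspace_V: "subspace V"
    and T_closed: "x \<in> V \<Longrightarrow> T x \<in> V"
    and independent_card: "independent S \<Longrightarrow> S \<subseteq> V \<Longrightarrow> finite S \<and> card S \<le> n"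
begin

lemma funpow_closed: "x \<in> V \<Longrightarrow> (T ^^ i) x \<in> V"
  by (induction i) (simp_all add: T_closed)

lemma act_closed: "x \<in> V \<Longrightarrow> act p x \<in> V"
  unfolding poly_act_def
  by (intro subspace_sum subspace_scale subspace_V funpow_closed)

lemma ex_annihilator_gen:
  assumes "x \<in> V"
  shows "\<exists>p. annihilator_gen p x"
proof (rule ccontr)
  assume none: "\<not> ?thesis"
  then have nz: "act q x \<noteq> 0" if "q \<noteq> 0" for q using annihilator_gen_exists that by blast
  define S where "S = (\<lambda>i. (T ^^ i) x) ` {..<Suc n}"
  have "card S = Suc n"
    unfolding S_def using powers_independent(1)[of "Suc n" x] nz by (simp add: card_image)
  moreover have "independent S"
    unfolding S_def using powers_independent(2)[of "Suc n" x] nz by blast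
  moreover have "S \<subseteq> V" using assms by (auto simp: S_def funpow_closed)
  ultimately show False using independent_card[of S] by simp
qed

lemma
  assumes p: "annihilator_gen p x" and x: "x \<in> V"
  shows degree_annihilator_le: "Polynomial.degree p \<le> n"
    and degree_annihilator_less: "y \<in> V \<Longrightarrow> y \<notin> range (\<lambda>q. act q x) \<Longrightarrow> Polynomial.degree p < n"
proof -
  define S where "S = (\<lambda>i. (T ^^ i) x) ` {..<Polynomial.degree p}"
  have nz: "act q x \<noteq> 0" if "q \<noteq> 0" "Polynomial.degree q < Polynomial.degree p" for q
    using p that dvd_imp_degree_le[of p q] by (auto simp: annihilator_gen_def)
  have card: "card S = Polynomial.degree p"
    unfolding S_def using powers_independent(1)[of "Polynomial.degree p" x] nz by (simp add: card_image)
  have ind: "independent S"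
    unfolding S_def using powers_independent(2)[of "Polynomial.degree p" x] nz by blast
  have SV: "S \<subseteq> V" using x by (auto simp: S_def funpow_closed)
  show "Polynomial.degree p \<le> n" using independent_card[OF ind SV] card by simp
  assume y: "y \<in> V" "y \<notin> range (\<lambda>q. act q x)"
  have "span S \<subseteq> range (\<lambda>q. act q x)"
  proof (rule span_minimal)
    show "S \<subseteq> range (\<lambda>q. act q x)"
    proof
      fix z assume "z \<in> S"
      then obtain i where "z = act (Polynomial.monom 1 i) x" by (auto simp: S_def act_monom)
      then show "z \<in> range (\<lambda>q. act q x)" by blast
    qed
    show "subspace (range (\<lambda>q. act q x))"
    proof (rule subspaceI)
      show "0 \<in> range (\<lambda>q. act q x)" by (metis act_0 rangeI)
    qed (auto simp flip: act_add act_smult)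
  qed
  then have "y \<notin> span S" using y by blast
  moreover from this have "y \<notin> S" using span_base by blast
  ultimately have "independent (insert y S)" "y \<notin> S" using ind by (simp_all add: independent_insert)
  then show "Polynomial.degree p < n"
    using independent_card[of "insert y S"] SV y card independent_card[OF ind SV] by simp
qed

text \<open>
  Take, among the nonzero vectors of the cyclic subspace generated by \<open>x\<close>, one whose annihilator has the
  least possible degree: a proper factorisation of its annihilator would give a smaller one.
\<close>

lemma ex_irreducible_annihilator:
  assumes "x \<in> V" "x \<noteq> 0"
  shows "\<exists>r f. Factorial_Ring.irreducible f \<and> act r x \<noteq> 0 \<and> act f (act r x) = 0"
proof -
  define Q where "Q = (\<lambda>g. g \<noteq> 0 \<and> (\<exists>r. act r x \<noteq> 0 \<and> act g (act r x) = 0))"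
  obtain p where "annihilator_gen p x" using ex_annihilator_gen assms by blast
  then have "p \<noteq> 0" "act 1 x \<noteq> 0" "act p (act 1 x) = 0"
    using assms by (auto simp: annihilator_gen_def)
  then have "Q p" unfolding Q_def by blast
  then obtain f where f: "Q f" and least: "\<And>g. Q g \<Longrightarrow> Polynomial.degree f \<le> Polynomial.degree g"
    using ex_has_least_nat[of Q p Polynomial.degree] by blast
  then obtain r where r: "act r x \<noteq> 0" "act f (act r x) = 0" and "f \<noteq> 0" by (auto simp: Q_def)
  have "Factorial_Ring.irreducible f"
  proof (rule Factorial_Ring.irreducibleI)
    show "\<not> is_unit f"
    proof
      assume "is_unit f"
      then obtain e where "1 = f * e" by blast
      then have "act r x = act e (act f (act r x))" by (metis act_1 act_mult')
      then show False using r by simp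
    qed
    fix a b assume ab: "f = a * b"
    show "is_unit a \<or> is_unit b"
    proof (cases "act b (act r x) = 0")
      case True
      then have "Q b" using r \<open>f \<noteq> 0\<close> ab by (auto simp: Q_def)
      then have "Polynomial.degree f \<le> Polynomial.degree b" by (rule least)
      then show ?thesis using ab \<open>f \<noteq> 0\<close> by (auto simp: Polynomial.degree_mult_eq is_unit_iff_degree)
    next
      case False
      then have "act (b * r) x \<noteq> 0 \<and> act a (act (b * r) x) = 0"
        using r ab by (simp add: act_mult)
      then have "Q a" using \<open>f \<noteq> 0\<close> ab unfolding Q_def by auto
      then have "Polynomial.degree f \<le> Polynomial.degree a" by (rule least)
      then show ?thesis using ab \<open>f \<noteq> 0\<close> by (auto simp: Polynomial.degree_mult_eq is_unit_iff_degree)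
    qed
  qed (fact \<open>f \<noteq> 0\<close>)
  then show ?thesis using r by blast
qed

text \<open>
  Choose \<open>v\<close> with annihilator \<open>m\<close> of largest degree.  If \<open>m\<close> does not kill some \<open>x\<close>, there are
  an irreducible \<open>f\<close> and a multiple \<open>y\<close> of \<open>x\<close> killed by \<open>f\<^bsup>j+1\<^esup>\<close> but not by \<open>f\<^sup>j\<close>, where \<open>f\<^sup>j\<close> is
  the exact power of \<open>f\<close> in \<open>m = f\<^sup>j h\<close>.  Then the annihilator of \<open>y + f\<^sup>j v\<close> is divisible by
  \<open>f\<^bsup>j+1\<^esup>\<close> and by \<open>h\<close>, hence by \<open>f m\<close>, which contradicts the choice of \<open>v\<close>.
\<close>

lemma ex_vector_with_minimal_polynomial:
  "\<exists>v m. v \<in> V \<and> annihilator_gen m v \<and> (\<forall>x\<in>V. act m x = 0)"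
proof -
  define Q where "Q = (\<lambda>(v, m). v \<in> V \<and> annihilator_gen m v)"
  have "0 \<in> V" using subspace_V by (rule subspace_0)
  then obtain m0 where "Q (0, m0)" using ex_annihilator_gen by (auto simp: Q_def)
  moreover have "\<forall>y. Q y \<longrightarrow> Polynomial.degree (snd y) < Suc n"
    using degree_annihilator_le by (auto simp: Q_def less_Suc_eq_le)
  ultimately obtain w where w: "Q w"
    and greatest: "\<And>y. Q y \<Longrightarrow> Polynomial.degree (snd y) \<le> Polynomial.degree (snd w)"
    using ex_has_greatest_nat[of Q "(0, m0)" "\<lambda>y. Polynomial.degree (snd y)" "Suc n"]
    by metis
  obtain v m where vm: "w = (v, m)" by (cases w)
  have v: "v \<in> V" and m: "m \<noteq> 0" "\<And>q. act q v = 0 \<longleftrightarrow> m dvd q"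
    and ann: "annihilator_gen m v"
    using w vm by (auto simp: Q_def annihilator_gen_def)
  have "act m x = 0" if x: "x \<in> V" for x
  proof (rule ccontr)
    assume "act m x \<noteq> 0"
    then obtain r f where f: "Factorial_Ring.irreducible f"
      and r: "act r (act m x) \<noteq> 0" "act f (act r (act m x)) = 0"
      using ex_irreducible_annihilator[of "act m x"] act_closed[OF x] by blast
    obtain j h where jh: "m = f ^ j * h" "\<not> f dvd h" using factor_out_power[OF f \<open>m \<noteq> 0\<close>] by blast
    define y where "y = act (h * r) x"
    define w' where "w' = y + act (f ^ j) v"
    have "y \<in> V" unfolding y_def by (rule act_closed[OF x])
    have "r * m = f ^ j * (h * r)" by (simp add: jh mult_ac)
    then have y0: "act (f ^ j) y = act r (act m x)" by (simp only: y_def act_mult[symmetric])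
    then have y1: "act (f ^ j) y \<noteq> 0" using r by simp
    have y2: "act (f ^ Suc j) y = 0" using r by (simp add: act_mult y0)
    have "w' \<in> V"
      unfolding w'_def by (intro subspace_add subspace_V act_closed v \<open>y \<in> V\<close>)
    then obtain g where g: "annihilator_gen g w'" using ex_annihilator_gen by blast
    then have "act g w' = 0" "g \<noteq> 0" by (auto simp: annihilator_gen_def)
    have y3: "act (f ^ Suc j * g) y = 0" using y2 by (simp only: act_mult' act_vec_0)
    \<comment> \<open>Multiplying by \<open>f\<^bsup>j+1\<^esup>\<close> removes the summand \<open>y\<close>.\<close>
    have "h dvd g"
    proof -
      have "act (f ^ Suc j) (act g w') = act (f ^ Suc j * g) (y + act (f ^ j) v)"
        by (simp add: act_mult w'_def del: power_Suc)
      also have "\<dots> = act (f ^ Suc j * g * f ^ j) v"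
        using y3 by (simp add: act_vec_add act_mult del: power_Suc)
      finally have "m dvd f ^ Suc j * g * f ^ j" using m \<open>act g w' = 0\<close> by simp
      then have "f ^ j * h dvd f ^ j * (f ^ Suc j * g)" by (simp add: jh mult_ac)
      moreover have "f ^ j \<noteq> 0" using f by auto
      ultimately have hfg: "h dvd f ^ Suc j * g" by (simp only: dvd_mult_cancel_left) simp
      obtain a b where "a * f ^ Suc j + b * h = 1"
        using bezout_irreducible_power[OF f jh(2)] by blast
      then have "g = (a * f ^ Suc j + b * h) * g" by simp
      also have "\<dots> = a * (f ^ Suc j * g) + h * (b * g)" by (simp add: algebra_simps)
      finally have "g = a * (f ^ Suc j * g) + h * (b * g)" .
      then show ?thesis
        using dvd_add[OF dvd_mult[OF hfg, of a] dvd_triv_left[of h "b * g"]] by simp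
    qed
    \<comment> \<open>Multiplying by \<open>h\<close> removes the summand \<open>f\<^sup>j v\<close>.\<close>
    moreover have "f ^ Suc j dvd g"
    proof (rule irreducible_power_dvd_cancel[OF f jh(2)])
      have "act h (act g w') = act (h * g) y + act (h * g * f ^ j) v"
        by (simp only: act_mult w'_def act_vec_add)
      also have "h * g * f ^ j = g * m" by (simp add: jh mult_ac)
      also have "act (g * m) v = 0" using m by simp
      finally have hg: "act (h * g) y = 0" using \<open>act g w' = 0\<close> by simp
      show "f ^ Suc j dvd h * g"
      proof (cases "h * g = 0")
        case False
        obtain i k where ik: "h * g = f ^ i * k" "\<not> f dvd k" using factor_out_power[OF f False] by blast
        have "act (f ^ i) y = 0"
        proof -
          obtain a b where ab: "a * f ^ Suc j + b * k = 1"
            using bezout_irreducible_power[OF f ik(2)] by blast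
          have "act (f ^ i) y = act (f ^ i * (a * f ^ Suc j + b * k)) y" by (simp only: ab mult_1_right)
          also have "f ^ i * (a * f ^ Suc j + b * k) = (f ^ i * a) * f ^ Suc j + b * (h * g)"
            unfolding ik(1) by (simp add: algebra_simps)
          also have "act \<dots> y = 0" using hg y2 by (simp only: act_add act_mult[of "f ^ i * a"] act_mult[of b]) simp
          finally show ?thesis .
        qed
        have "Suc j \<le> i"
        proof (rule ccontr)
          assume "\<not> Suc j \<le> i"
          then have "f ^ j = f ^ (j - i) * f ^ i" by (simp flip: power_add)
          then show False using y1 \<open>act (f ^ i) y = 0\<close> by (simp add: act_mult)
        qed
        then show ?thesis unfolding ik(1) by (intro dvd_mult2 le_imp_power_dvd)
      qed auto
    qed
    ultimately have "f * m dvd g"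
    proof -
      assume "h dvd g" "f ^ Suc j dvd g"
      then obtain q where q: "g = h * q" by blast
      then have "f ^ Suc j dvd q"
        using irreducible_power_dvd_cancel[OF f jh(2), of "Suc j" q] \<open>f ^ Suc j dvd g\<close>
        by (simp only: q)
      then have "h * f ^ Suc j dvd h * q" by (intro mult_dvd_mono) simp
      then show ?thesis by (simp add: q jh mult_ac)
    qed
    then have "Polynomial.degree (f * m) \<le> Polynomial.degree g"
      using \<open>g \<noteq> 0\<close> by (rule dvd_imp_degree_le)
    moreover have "Polynomial.degree (f * m) = Polynomial.degree f + Polynomial.degree m"
      using f \<open>m \<noteq> 0\<close> by (intro Polynomial.degree_mult_eq) auto
    moreover have "Polynomial.degree f > 0"
      using f by (auto simp: Factorial_Ring.irreducible_def is_unit_iff_degree)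
    moreover have "Polynomial.degree g \<le> Polynomial.degree m"
      using greatest[of "(w', g)"] g \<open>w' \<in> V\<close> vm by (simp add: Q_def)
    ultimately show False by simp
  qed
  then show ?thesis using v ann by blast
qed

end

definition (in vector_space) endomorphism_on :: "'b set \<Rightarrow> ('b \<Rightarrow> 'b) \<Rightarrow> bool" where
  "endomorphism_on V F \<longleftrightarrow> (\<forall>x\<in>V. F x \<in> V) \<and> (\<forall>x\<in>V. \<forall>y\<in>V. F (x + y) = F x + F y) \<and>
    (\<forall>r. \<forall>x\<in>V. F (r *s x) = r *s F x)"

section \<open>Projecting onto a maximal cyclic subspace\<close>

text \<open>
  The functional that reads off the last coordinate with respect to the basis
  \<open>v, T v, \<dots>\<close> of the cyclic subspace.  It is used twice: its vanishing locus yields an invariant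
  complement of the cyclic subspace, and in the cyclic case it induces the Frobenius form.
\<close>

lemma (in linear_operator) ex_dual_functional:
  assumes "annihilator_gen m v"
  shows "\<exists>\<phi> :: 'v \<Rightarrow> 'a. (\<forall>x y. \<phi> (x + y) = \<phi> x + \<phi> y) \<and> (\<forall>r x. \<phi> (r *s x) = r * \<phi> x) \<and>
    (\<forall>i<Polynomial.degree m. \<phi> ((T ^^ i) v) = (if Suc i = Polynomial.degree m then 1 else 0))"
proof -
  interpret pair: vector_space_pair scale "(*) :: 'a \<Rightarrow> 'a \<Rightarrow> 'a"
    by unfold_locales (simp_all add: algebra_simps)
  let ?d = "Polynomial.degree m"
  let ?p = "\<lambda>i. (T ^^ i) v"
  have nz: "act q v \<noteq> 0" if "q \<noteq> 0" "Polynomial.degree q < ?d" for q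
    using assms that dvd_imp_degree_le[of m q] by (auto simp: annihilator_gen_def)
  have inj: "inj_on ?p {..<?d}" and ind: "independent (?p ` {..<?d})"
    using powers_independent[of ?d v] nz by blast+
  obtain \<phi> where \<phi>: "Vector_Spaces.linear scale (*) \<phi>"
    "\<And>x. x \<in> ?p ` {..<?d} \<Longrightarrow> \<phi> x = (if x = ?p (?d - 1) then 1 else 0)"
    using pair.linear_independent_extend[OF ind, of "\<lambda>x. if x = ?p (?d - 1) then 1 else 0"] by blast
  have "\<phi> (?p i) = (if Suc i = ?d then 1 else 0)" if i: "i < ?d" for i
  proof -
    have "?p i = ?p (?d - 1) \<longleftrightarrow> i = ?d - 1" using inj_on_eq_iff[OF inj, of i "?d - 1"] i by simp
    then show ?thesis using \<phi>(2)[of "?p i"] i by auto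
  qed
  then show ?thesis
    using pair.linear_add[OF \<phi>(1)] pair.linear_scale[OF \<phi>(1)] by blast
qed

text \<open>
  Here \<open>m\<close> is the minimal polynomial of \<open>T\<close> on \<open>V\<close>, attained as the annihilator of the single vector
  \<open>v\<close>.
\<close>

locale maximal_cyclic = invariant_subspace scale T V n
  for scale :: "'a::field \<Rightarrow> 'v::ab_group_add \<Rightarrow> 'v"  (infixr \<open>*s\<close> 75)
    and T :: "'v \<Rightarrow> 'v" and V :: "'v set" and n :: nat +
  fixes v :: 'v and m :: "'a poly" and \<phi> :: "'v \<Rightarrow> 'a"
  assumes v: "v \<in> V"
    and ann: "annihilator_gen m v"
    and kills: "x \<in> V \<Longrightarrow> act m x = 0"
    and \<phi>_add: "\<phi> (x + y) = \<phi> x + \<phi> y"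
    and \<phi>_scale: "\<phi> (r *s x) = r * \<phi> x"
    and \<phi>_powers: "i < Polynomial.degree m \<Longrightarrow>
      \<phi> ((T ^^ i) v) = (if Suc i = Polynomial.degree m then 1 else 0)"
begin

lemma m_nonzero: "m \<noteq> 0"
  using ann by (simp add: annihilator_gen_def)

lemma act_v_eq_0_iff: "act q v = 0 \<longleftrightarrow> m dvd q"
  using ann by (simp add: annihilator_gen_def)

lemma \<phi>_0 [simp]: "\<phi> 0 = 0"
  using \<phi>_scale[of 0 0] by simp

lemma \<phi>_diff: "\<phi> (x - y) = \<phi> x - \<phi> y"
  using \<phi>_add[of "x - y" y] by simp

lemma \<phi>_sum: "\<phi> (\<Sum>i\<in>A. g i) = (\<Sum>i\<in>A. \<phi> (g i))"
  by (induction A rule: infinite_finite_induct) (simp_all add: \<phi>_add)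

lemma \<phi>_act: "\<phi> (act q x) = (\<Sum>i\<le>Polynomial.degree q. Polynomial.coeff q i * \<phi> ((T ^^ i) x))"
  by (simp add: poly_act_def \<phi>_sum \<phi>_scale)

lemma act_mod: "x \<in> V \<Longrightarrow> act (q mod m) x = act q x"
proof -
  assume x: "x \<in> V"
  have "act q x = act (q div m * m + q mod m) x" by simp
  also have "\<dots> = act (q mod m) x" using kills[OF x] by (simp only: act_add act_mult) simp
  finally show ?thesis by simp
qed

lemma \<phi>_act_eq_0:
  assumes "x \<in> V" and z: "\<And>i. i < Polynomial.degree m \<Longrightarrow> \<phi> ((T ^^ i) x) = 0"
  shows "\<phi> (act q x) = 0"
proof -
  have "act q x = act (q mod m) x" using act_mod assms by simp
  moreover have "Polynomial.coeff (q mod m) i * \<phi> ((T ^^ i) x) = 0" if "i \<le> Polynomial.degree (q mod m)" for i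
  proof (cases "q mod m = 0")
    case False
    then have "Polynomial.degree (q mod m) < Polynomial.degree m"
      using degree_mod_less[OF m_nonzero, of q] by simp
    then show ?thesis using z that by simp
  qed simp
  ultimately show ?thesis by (simp only: \<phi>_act) (intro sum.neutral, simp)
qed

text \<open>
  If \<open>r\<close> has degree \<open>e < d\<close>, then \<open>T\<^bsup>d-1-e\<^esup>\<close> moves the leading term of \<open>r\<close> to
  \<open>T\<^bsup>d-1\<^esup> v\<close>, so that \<open>\<phi>\<close> sees the leading coefficient.
\<close>

lemma \<phi>_nondegenerate:
  assumes z: "\<And>i. i < Polynomial.degree m \<Longrightarrow> \<phi> ((T ^^ i) (act q v)) = 0"
  shows "act q v = 0"
proof (rule ccontr)
  assume nz: "act q v \<noteq> 0"
  let ?r = "q mod m" and ?d = "Polynomial.degree m"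
  let ?e = "Polynomial.degree ?r"
  have r: "act ?r v = act q v" using act_mod v by simp
  then have "?r \<noteq> 0" using nz by auto
  then have e: "?e < ?d" using degree_mod_less[OF m_nonzero, of q] by simp
  have "\<phi> ((T ^^ (?d - 1 - ?e)) (act ?r v))
      = (\<Sum>i\<le>?e. Polynomial.coeff ?r i * \<phi> ((T ^^ i) ((T ^^ (?d - 1 - ?e)) v)))"
    by (simp only: funpow_act \<phi>_act)
  also have "\<dots> = (\<Sum>i\<le>?e. if i = ?e then Polynomial.coeff ?r i else 0)"
  proof (rule sum.cong)
    fix i assume "i \<in> {..?e}"
    then have "i + (?d - 1 - ?e) < ?d" "Suc (i + (?d - 1 - ?e)) = ?d \<longleftrightarrow> i = ?e" using e by auto
    moreover have "(T ^^ i) ((T ^^ (?d - 1 - ?e)) v) = (T ^^ (i + (?d - 1 - ?e))) v"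
      by (simp add: funpow_add)
    ultimately show "Polynomial.coeff ?r i * \<phi> ((T ^^ i) ((T ^^ (?d - 1 - ?e)) v))
        = (if i = ?e then Polynomial.coeff ?r i else 0)"
      using \<phi>_powers[of "i + (?d - 1 - ?e)"] by simp
  qed simp
  also have "\<dots> = Polynomial.coeff ?r ?e" by simp
  finally show False using z[of "?d - 1 - ?e"] e \<open>?r \<noteq> 0\<close> r by simp
qed

text \<open>
  The system is triangular: the coefficient of \<open>X\<^bsup>d-1-k\<^esup>\<close> influences the value at \<open>k\<close> with factor
  \<open>1\<close> and none of the earlier values.
\<close>

lemma ex_prescribed_values: "\<exists>p. \<forall>i<Polynomial.degree m. \<phi> ((T ^^ i) (act p v)) = t i"
proof -
  let ?d = "Polynomial.degree m"
  have "\<exists>p. \<forall>i<k. \<phi> ((T ^^ i) (act p v)) = t i" if "k \<le> ?d" for k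
    using that
  proof (induction k)
    case (Suc k)
    then obtain p where p: "\<And>i. i < k \<Longrightarrow> \<phi> ((T ^^ i) (act p v)) = t i" by auto
    define c where "c = t k - \<phi> ((T ^^ k) (act p v))"
    have "\<phi> ((T ^^ i) (act (p + Polynomial.monom c (?d - Suc k)) v)) = t i" if i: "i < Suc k" for i
    proof -
      have "\<phi> ((T ^^ i) (act (p + Polynomial.monom c (?d - Suc k)) v))
          = \<phi> ((T ^^ i) (act p v)) + c * \<phi> ((T ^^ (i + (?d - Suc k))) v)"
        by (simp add: act_add act_monom funpow_T_add funpow_T_scale \<phi>_add \<phi>_scale funpow_add)
      then show ?thesis
        using \<phi>_powers[of "i + (?d - Suc k)"] Suc.prems i p[of i]
        by (cases "i = k") (auto simp: c_def)
    qed
    then show ?case by blast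
  qed simp
  then show ?thesis by blast
qed

text \<open>
  Modulo the invariant subspace of all \<open>u\<close> with \<open>\<phi> (T\<^sup>i u) = 0\<close> for each \<open>i\<close>, the vector \<open>x\<close> equals
  \<open>p v\<close>.
\<close>

definition represents :: "'a poly \<Rightarrow> 'v \<Rightarrow> bool" where
  "represents p x \<longleftrightarrow> (\<forall>i. \<phi> ((T ^^ i) x) = \<phi> ((T ^^ i) (act p v)))"

lemma ex_represents:
  assumes x: "x \<in> V"
  shows "\<exists>p. represents p x"
proof -
  obtain p where p: "\<And>i. i < Polynomial.degree m \<Longrightarrow> \<phi> ((T ^^ i) (act p v)) = \<phi> ((T ^^ i) x)"
    using ex_prescribed_values[of "\<lambda>i. \<phi> ((T ^^ i) x)"] by blast
  have "\<phi> (act q (x - act p v)) = 0" for q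
  proof (rule \<phi>_act_eq_0)
    show "x - act p v \<in> V" using x v by (intro subspace_diff subspace_V act_closed)
    show "\<phi> ((T ^^ i) (x - act p v)) = 0" if "i < Polynomial.degree m" for i
      using p[OF that] act_vec_diff[of "Polynomial.monom 1 i" x "act p v"]
      by (simp add: act_monom \<phi>_diff)
  qed
  then have "\<phi> (act (Polynomial.monom 1 i) x) = \<phi> (act (Polynomial.monom 1 i) (act p v))" for i
    by (simp add: act_vec_diff \<phi>_diff)
  then show ?thesis by (auto simp: represents_def act_monom)
qed

lemma represents_unique:
  assumes "represents p x" "represents q x" "y \<in> V"
  shows "act p y = act q y"
proof -
  have "\<phi> ((T ^^ i) (act (p - q) v)) = 0" for i
    using assms(1,2) act_vec_diff[of "Polynomial.monom 1 i" "act p v" "act q v"]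
    by (simp add: represents_def act_diff act_monom \<phi>_diff)
  then have "m dvd p - q" using \<phi>_nondegenerate by (simp flip: act_v_eq_0_iff)
  then obtain r where "p - q = r * m" by (metis dvd_def mult.commute)
  then have "act (p - q) y = 0" using kills[OF \<open>y \<in> V\<close>] by (simp add: act_mult)
  then show ?thesis by (simp add: act_diff)
qed

lemma represents_add: "represents p x \<Longrightarrow> represents q y \<Longrightarrow> represents (p + q) (x + y)"
  by (simp add: represents_def act_add funpow_T_add \<phi>_add)

lemma represents_smult: "represents p x \<Longrightarrow> represents (Polynomial.smult r p) (r *s x)"
  by (simp add: represents_def act_smult funpow_T_scale \<phi>_scale)

lemma represents_act:
  assumes "represents p x"
  shows "represents (q * p) (act q x)"
proof -
  have "\<phi> (act g x) = \<phi> (act g (act p v))" for g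
    using assms by (simp add: \<phi>_act represents_def)
  from this[of "Polynomial.monom 1 _ * q"] show ?thesis
    by (simp add: represents_def act_mult act_monom)
qed

lemma represents_act_v: "represents p (act p v)"
  by (simp add: represents_def)

text \<open>
  The homomorphism of \<open>K[T]\<close>-modules from \<open>V\<close> to \<open>K[T] y\<close> that sends \<open>v\<close> to \<open>y\<close> and kills the
  invariant complement of \<open>K[T] v\<close>.  In particular \<open>transport v\<close> is the projection onto \<open>K[T] v\<close>.
  All polynomials representing \<open>x\<close> give the same value, because they agree modulo \<open>m\<close> and \<open>m\<close>
  kills \<open>V\<close>.
\<close>

definition transport :: "'v \<Rightarrow> 'v \<Rightarrow> 'v" where
  "transport y x = act (SOME p. represents p x) y"

lemma transport_eq:
  assumes "represents p x" "y \<in> V"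
  shows "transport y x = act p y"
  unfolding transport_def
  using assms by (intro represents_unique[of _ x]) (auto intro: someI)

lemma transport_closed: "y \<in> V \<Longrightarrow> transport y x \<in> V"
  by (simp add: transport_def act_closed)

lemma transport_add:
  assumes "x \<in> V" "x' \<in> V" "y \<in> V"
  shows "transport y (x + x') = transport y x + transport y x'"
proof -
  obtain p p' where p: "represents p x" and p': "represents p' x'"
    using ex_represents assms by metis
  show ?thesis
    by (simp add: transport_eq[OF represents_add[OF p p']] transport_eq[OF p] transport_eq[OF p']
        assms(3) act_add)
qed

lemma transport_scale:
  assumes "x \<in> V" "y \<in> V"
  shows "transport y (r *s x) = r *s transport y x"
proof -
  obtain p where p: "represents p x" using ex_represents[OF assms(1)] by blast
  show ?thesis
    by (simp add: transport_eq[OF represents_smult[OF p]] transport_eq[OF p] assms(2) act_smult)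
qed

lemma transport_act:
  assumes "x \<in> V" "y \<in> V"
  shows "transport y (act q x) = act q (transport y x)"
proof -
  obtain p where p: "represents p x" using ex_represents[OF assms(1)] by blast
  show ?thesis
    by (simp add: transport_eq[OF represents_act[OF p]] transport_eq[OF p] assms(2) act_mult)
qed

lemma transport_act_v: "y \<in> V \<Longrightarrow> transport y (act p v) = act p y"
  by (rule transport_eq[OF represents_act_v])

lemma transport_complement:
  assumes x: "x \<in> V" and y: "y \<in> V"
  shows "transport y (x - transport v x) = 0"
proof -
  obtain p where p: "represents p x" using ex_represents[OF x] by blast
  have "transport v x = act p v" by (rule transport_eq[OF p v])
  then have "represents 0 (x - transport v x)"
    using represents_add[OF p represents_smult[OF represents_act_v, of "- 1" p]] by simp
  then show ?thesis using transport_eq[of 0 _ y] y by simp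
qed

text \<open>
  If \<open>K[T] v\<close> is not all of \<open>V\<close>, then \<open>T\<close> is a polynomial in some \<open>N\<close> that commutes with fewer
  operators.  Let \<open>E\<close> be the projection of \<open>V\<close> onto the \<open>f\<close>-primary part of the complement of
  \<open>K[T] v\<close>, where \<open>f\<close> is irreducible and this part is nonzero, and put \<open>N = T + s E\<close>.  On the image
  of \<open>E\<close> the operator \<open>N\<close> is killed by a power of \<open>f (X - s)\<close>, on the kernel by \<open>m\<close>; for a suitable
  \<open>s\<close> these polynomials are coprime and the Chinese remainder theorem gives \<open>q\<close> with \<open>q(N) = T\<close>.
  Since \<open>f\<close> divides \<open>m\<close>, there is a nonzero homomorphism \<open>H\<close> from \<open>K[T] v\<close> to the image of \<open>E\<close>; it
  commutes with \<open>T\<close> but not with \<open>E\<close>.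
\<close>

theorem noncyclic_refinement:
  assumes x0: "x0 \<in> V" "x0 \<notin> range (\<lambda>p. act p v)"
    and char: "Polynomial.degree m < CHAR('a)"
  shows "\<exists>N H q. endomorphism_on V N \<and> endomorphism_on V H \<and> (\<forall>x\<in>V. H (T x) = T (H x)) \<and>
    (\<exists>x\<in>V. N (H x) \<noteq> H (N x)) \<and> (\<forall>x\<in>V. poly_act N q x = T x)"
proof -
  define u0 where "u0 = x0 - transport v x0"
  have u0: "u0 \<in> V" unfolding u0_def by (intro subspace_diff subspace_V x0 transport_closed v)
  have "u0 \<noteq> 0"
    using x0(2) by (auto simp: u0_def transport_def)
  then obtain r f where f: "Factorial_Ring.irreducible f"
    and r: "act r u0 \<noteq> 0" "act f (act r u0) = 0"
    using ex_irreducible_annihilator u0 by blast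
  define u where "u = act r u0"
  have u: "u \<in> V" "u \<noteq> 0" "act f u = 0" using r u0 by (simp_all add: u_def act_closed)
  have tu: "transport y u = 0" if "y \<in> V" for y
    using transport_complement[OF x0(1) that] u0 that by (simp add: u_def transport_act u0_def[symmetric])
  have "f dvd m"
  proof (rule ccontr)
    assume "\<not> f dvd m"
    then obtain a b where "a * f ^ 1 + b * m = 1" using bezout_irreducible_power[OF f] by blast
    then have "act (a * f + b * m) u = u" by simp
    then show False using u kills[OF u(1)] by (simp add: act_add act_mult)
  qed
  obtain j h where jh: "m = f ^ j * h" "\<not> f dvd h" using factor_out_power[OF f m_nonzero] by blast
  have "j \<noteq> 0" using jh \<open>f dvd m\<close> by (cases j) auto
  \<comment> \<open>The element \<open>b h\<close> acts as the projection onto the \<open>f\<close>-primary part.\<close>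
  obtain a b where ab: "a * f ^ j + b * h = 1" using bezout_irreducible_power[OF f jh(2)] by blast
  have "Polynomial.degree f > 0"
    using f by (auto simp: Factorial_Ring.irreducible_def is_unit_iff_degree)
  then obtain s where s: "\<not> pcompose f [:- s, 1:] dvd m"
    using exists_shift_not_dvd[OF _ m_nonzero char] by blast
  have "s \<noteq> 0" using s \<open>f dvd m\<close> by (metis minus_zero pcompose_idR)
  obtain a' b' where ab': "a' * pcompose f [:- s, 1:] ^ j + b' * m = 1"
    using bezout_irreducible_power[OF irreducible_shift[OF f] s] by blast
  define E where "E = (\<lambda>x. act (b * h) (x - transport v x))"
  define N where "N = (\<lambda>x. T x + s *s E x)"
  \<comment> \<open>The polynomial \<open>q\<close> is congruent to \<open>X\<close> modulo \<open>m\<close> and to \<open>X - s\<close> modulo \<open>f (X - s)\<^sup>j\<close>.\<close>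
  define q where "q = [:0, 1:] - Polynomial.smult s (b' * m)"
  have E_closed: "E x \<in> V" if "x \<in> V" for x
    unfolding E_def by (intro act_closed subspace_diff subspace_V transport_closed v that)
  have E_add: "E (x + y) = E x + E y" if "x \<in> V" "y \<in> V" for x y
    using that v by (simp add: E_def transport_add add_diff_add act_vec_add)
  have E_scale: "E (c *s x) = c *s E x" if "x \<in> V" for x c
    using that v by (simp add: E_def transport_scale act_vec_scale[symmetric] scale_right_diff_distrib)
  have E_T: "E (T x) = T (E x)" if "x \<in> V" for x
    using transport_act[OF that v, of "[:0, 1:]"] act_vec_diff[of "[:0, 1:]" x "transport v x"]
    by (simp add: E_def act_X T_act)
  have fE: "act (f ^ j) (E x) = 0" if "x \<in> V" for x
  proof -
    have "act (f ^ j) (E x) = act (b * m) (x - transport v x)"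
      by (simp add: E_def jh mult_ac flip: act_mult)
    also have "\<dots> = 0"
      using kills[OF subspace_diff[OF subspace_V that transport_closed[OF v]]]
      by (simp add: act_mult)
    finally show ?thesis .
  qed
  have bh: "act (b * h) y = y" if "act (f ^ j) y = 0" for y
  proof -
    have "act (a * f ^ j + b * h) y = y" by (simp add: ab)
    then show ?thesis using that by (simp add: act_add act_mult)
  qed
  have E_idem: "E (E x) = E x" if x: "x \<in> V" for x
  proof -
    have "transport v (E x) = 0"
      unfolding E_def using transport_complement[OF x v] subspace_diff[OF subspace_V x transport_closed[OF v]]
      by (simp add: transport_act v)
    moreover have "E (E x) = act (b * h) (E x - transport v (E x))" by (simp only: E_def)
    ultimately have "E (E x) = act (b * h) (E x)" by simp
    then show ?thesis using bh[OF fE[OF x]] by simp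
  qed
  have H: "endomorphism_on V (transport u)"
    using u by (simp add: endomorphism_on_def transport_closed transport_add transport_scale)
  have N: "endomorphism_on V N"
    unfolding endomorphism_on_def N_def
    by (simp add: subspace_add subspace_scale subspace_V T_closed E_closed E_add E_scale T_add T_scale
        scale_right_distrib add_ac scale_left_commute)
  have HT: "transport u (T x) = T (transport u x)" if "x \<in> V" for x
    using transport_act[OF that u(1), of "[:0, 1:]"] by (simp add: act_X)
  have tv: "transport v v = v" "transport u v = u"
    using transport_act_v[of _ 1] u v by simp_all
  have "E v = 0" by (simp add: E_def tv)
  have "act (f ^ j) u = 0" using u \<open>j \<noteq> 0\<close> by (cases j) (simp_all add: act_mult')
  then have "E u = u" using tu[OF v] by (simp add: E_def bh)
  have NH: "N (transport u v) \<noteq> transport u (N v)"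
    using \<open>s \<noteq> 0\<close> u by (simp add: N_def tv \<open>E v = 0\<close> \<open>E u = u\<close> HT[OF v])
  have "poly_act N q x = T x" if x: "x \<in> V" for x
  proof -
    define y where "y = E x"
    define z where "z = x - y"
    let ?S = "\<lambda>w. T w + s *s w"
    have y: "y \<in> V" "E y = y" using x E_closed E_idem by (simp_all add: y_def)
    have z: "z \<in> V" unfolding z_def by (intro subspace_diff subspace_V x y)
    have "E x = E z + E y" using E_add[OF z y(1)] by (simp add: z_def)
    then have "E z = 0" using y by (simp add: y_def)
    have step: "(N ^^ i) (z + y) = (T ^^ i) z + (?S ^^ i) y \<and> (?S ^^ i) y \<in> V \<and>
        E ((T ^^ i) z) = 0 \<and> E ((?S ^^ i) y) = (?S ^^ i) y" for i
    proof (induction i)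
      case (Suc i)
      define z' y' where "z' = (T ^^ i) z" and "y' = (?S ^^ i) y"
      have z': "z' \<in> V" "E z' = 0" and y': "y' \<in> V" "E y' = y'" and N': "(N ^^ i) (z + y) = z' + y'"
        using Suc funpow_closed[OF z] by (simp_all add: z'_def y'_def)
      have "N (z' + y') = T z' + ?S y'"
        using E_add[OF z'(1) y'(1)] z' y' by (simp add: N_def T_add add_ac)
      moreover have "?S y' \<in> V" by (intro subspace_add subspace_scale subspace_V T_closed y')
      moreover have "E (T z') = 0" using E_T[OF z'(1)] z' by simp
      moreover have "E (?S y') = ?S y'"
        using y' E_add[OF T_closed[OF y'(1)] subspace_scale[OF subspace_V y'(1)], of s]
        by (simp add: E_T E_scale)
      ultimately show ?case using N' by (simp add: z'_def[symmetric] y'_def[symmetric])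
    qed (use y \<open>E z = 0\<close> in simp)
    have "poly_act N q x = act q z + poly_act ?S q y"
      using step by (simp add: poly_act_def z_def scale_right_distrib sum.distrib)
    also have "act q z = T z"
      using kills[OF z] by (simp add: q_def act_diff act_smult act_mult act_X)
    also have "poly_act ?S q y = act (pcompose q [:s, 1:]) y" by (rule poly_act_translate)
    also have "\<dots> = T y"
    proof -
      have inv: "pcompose (pcompose f [:- s, 1:]) [:s, 1:] = f"
        by (simp add: pcompose_assoc[symmetric] pcompose_pCons)
      have "pcompose (pcompose f [:- s, 1:] ^ k) [:s, 1:] = f ^ k" for k
        by (induction k) (simp_all add: pcompose_mult pcompose_1 inv)
      then have "pcompose a' [:s, 1:] * f ^ j + pcompose (b' * m) [:s, 1:] = 1"
        using arg_cong[OF ab', of "\<lambda>p. pcompose p [:s, 1:]"]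
        by (simp add: pcompose_add pcompose_mult pcompose_1)
      then have "act (pcompose a' [:s, 1:] * f ^ j + pcompose (b' * m) [:s, 1:]) y = y" by simp
      then have "act (pcompose (b' * m) [:s, 1:]) y = y"
        using fE[OF x] by (simp add: act_add act_mult y_def)
      moreover have "pcompose q [:s, 1:] = [:s, 1:] - Polynomial.smult s (pcompose (b' * m) [:s, 1:])"
        by (simp add: q_def pcompose_diff pcompose_smult pcompose_pCons)
      ultimately show ?thesis by (simp add: act_diff act_smult act_pCons)
    qed
    also have "T z + T y = T x" by (simp add: z_def flip: T_add)
    finally show ?thesis .
  qed
  then show ?thesis using N H HT NH v by blast
qed

end

section \<open>A criterion for Frobenius algebras\<close>

text \<open>
  The elements \<open>y\<close> of \<open>Y\<close> and the \<open>x y\<close> are meant to be dual bases of \<open>A\<close> for the bilinear form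
  \<open>form (a b)\<close>.  That they span is expressed by nondegeneracy on either side.
\<close>

locale frobenius_form = field R + f: ring_hom_ring R A f
  for R (structure) and A :: "('c, 'd) ring_scheme" and f +
  fixes form :: "'c \<Rightarrow> 'a" and Y :: "'c set" and x :: "'c \<Rightarrow> 'c"
  assumes central: "r \<in> carrier R \<Longrightarrow> a \<in> carrier A \<Longrightarrow> f r \<otimes>\<^bsub>A\<^esub> a = a \<otimes>\<^bsub>A\<^esub> f r"
    and form_closed: "a \<in> carrier A \<Longrightarrow> form a \<in> carrier R"
    and form_add: "a \<in> carrier A \<Longrightarrow> b \<in> carrier A \<Longrightarrow> form (a \<oplus>\<^bsub>A\<^esub> b) = form a \<oplus> form b"
    and form_scale: "r \<in> carrier R \<Longrightarrow> a \<in> carrier A \<Longrightarrow> form (f r \<otimes>\<^bsub>A\<^esub> a) = r \<otimes> form a"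
    and Y: "finite Y" "Y \<subseteq> carrier A"
    and x: "y \<in> Y \<Longrightarrow> x y \<in> carrier A"
    and dual: "y \<in> Y \<Longrightarrow> z \<in> Y \<Longrightarrow> form (y \<otimes>\<^bsub>A\<^esub> x z) = (if z = y then \<one> else \<zero>)"
    and nondeg_left: "a \<in> carrier A \<Longrightarrow> (\<And>y. y \<in> Y \<Longrightarrow> form (a \<otimes>\<^bsub>A\<^esub> x y) = \<zero>) \<Longrightarrow> a = \<zero>\<^bsub>A\<^esub>"
    and nondeg_right: "a \<in> carrier A \<Longrightarrow> (\<And>y. y \<in> Y \<Longrightarrow> form (y \<otimes>\<^bsub>A\<^esub> a) = \<zero>) \<Longrightarrow> a = \<zero>\<^bsub>A\<^esub>"
begin

lemma Y_carrier: "y \<in> Y \<Longrightarrow> y \<in> carrier A"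
  using Y by blast

lemma scalar_pull:
  assumes "r \<in> carrier R" "a \<in> carrier A" "b \<in> carrier A"
  shows "a \<otimes>\<^bsub>A\<^esub> (f r \<otimes>\<^bsub>A\<^esub> b) = f r \<otimes>\<^bsub>A\<^esub> (a \<otimes>\<^bsub>A\<^esub> b)"
  using central[of r a] assms by (simp add: f.S.m_assoc[symmetric])

text \<open>
  The elements of \<open>Hom(A\<^sub>R, R\<^sub>R)\<close>, up to their values outside the carrier.
\<close>

definition is_functional :: "('c \<Rightarrow> 'a) \<Rightarrow> bool" where
  "is_functional h \<longleftrightarrow> h \<in> carrier A \<rightarrow> carrier R \<and>
    (\<forall>a\<in>carrier A. \<forall>b\<in>carrier A. h (a \<oplus>\<^bsub>A\<^esub> b) = h a \<oplus> h b) \<and>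
    (\<forall>a\<in>carrier A. \<forall>r\<in>carrier R. h (a \<otimes>\<^bsub>A\<^esub> f r) = h a \<otimes> r)"

lemma functional_finsum:
  assumes h: "is_functional h" and "finite S" "g \<in> S \<rightarrow> carrier A"
  shows "h (finsum A g S) = finsum R (\<lambda>i. h (g i)) S"
  using assms(2,3)
proof (induction S rule: finite_induct)
  case empty
  have "h \<zero>\<^bsub>A\<^esub> \<in> carrier R" "h (\<zero>\<^bsub>A\<^esub> \<oplus>\<^bsub>A\<^esub> \<zero>\<^bsub>A\<^esub>) = h \<zero>\<^bsub>A\<^esub> \<oplus> h \<zero>\<^bsub>A\<^esub>"
    using h unfolding is_functional_def by blast+
  then show ?case by simp
next
  case (insert i S)
  have closed: "\<And>j. j \<in> insert i S \<Longrightarrow> h (g j) \<in> carrier R"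
    and add: "h (g i \<oplus>\<^bsub>A\<^esub> finsum A g S) = h (g i) \<oplus> h (finsum A g S)"
    using h insert.prems unfolding is_functional_def by (auto simp: Pi_iff)
  have "finsum A g (insert i S) = g i \<oplus>\<^bsub>A\<^esub> finsum A g S"
    using insert by (intro f.S.finsum_insert) (auto simp: Pi_iff)
  moreover have "finsum R (\<lambda>i. h (g i)) (insert i S) = h (g i) \<oplus> finsum R (\<lambda>i. h (g i)) S"
    using insert closed by (intro finsum_insert) auto
  ultimately show ?case using insert add by auto
qed

lemma form_translate_functional:
  assumes "a \<in> carrier A"
  shows "is_functional (\<lambda>b. form (a \<otimes>\<^bsub>A\<^esub> b))"
  unfolding is_functional_def
proof (intro conjI ballI)
  fix b r assume br: "b \<in> carrier A" "r \<in> carrier R"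
  have "a \<otimes>\<^bsub>A\<^esub> (b \<otimes>\<^bsub>A\<^esub> f r) = f r \<otimes>\<^bsub>A\<^esub> (a \<otimes>\<^bsub>A\<^esub> b)"
    using assms br central[of r "a \<otimes>\<^bsub>A\<^esub> b"] by (simp add: f.S.m_assoc)
  then show "form (a \<otimes>\<^bsub>A\<^esub> (b \<otimes>\<^bsub>A\<^esub> f r)) = form (a \<otimes>\<^bsub>A\<^esub> b) \<otimes> r"
    using assms br by (simp add: form_scale form_closed m_comm)
qed (use assms in \<open>auto simp: form_closed form_add f.S.r_distr\<close>)

lemma form_functional: "is_functional form"
  unfolding is_functional_def
  using central form_scale by (auto simp: form_closed form_add m_comm simp flip: central)

lemma functional_minus:
  assumes h: "is_functional h" and a: "a \<in> carrier A" and b: "b \<in> carrier A"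
  shows "h (a \<ominus>\<^bsub>A\<^esub> b) = h a \<ominus> h b"
proof -
  have c: "h (a \<ominus>\<^bsub>A\<^esub> b) \<in> carrier R" "h b \<in> carrier R"
    using h a b unfolding is_functional_def by auto
  have "h ((a \<ominus>\<^bsub>A\<^esub> b) \<oplus>\<^bsub>A\<^esub> b) = h (a \<ominus>\<^bsub>A\<^esub> b) \<oplus> h b"
    using h a b unfolding is_functional_def by blast
  moreover have "(a \<ominus>\<^bsub>A\<^esub> b) \<oplus>\<^bsub>A\<^esub> b = a"
    using a b by (simp add: f.S.minus_eq f.S.a_assoc f.S.l_neg)
  ultimately have e: "h a = h (a \<ominus>\<^bsub>A\<^esub> b) \<oplus> h b" by simp
  show ?thesis unfolding e using c by (simp add: minus_eq a_assoc r_neg)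
qed

lemmas form_minus = functional_minus[OF form_functional]
lemmas form_finsum = functional_finsum[OF form_functional]

definition comb :: "('c \<Rightarrow> 'a) \<Rightarrow> 'c" where
  "comb r = finsum A (\<lambda>y. y \<otimes>\<^bsub>A\<^esub> f (r y)) Y"

definition comb_dual :: "('c \<Rightarrow> 'a) \<Rightarrow> 'c" where
  "comb_dual r = finsum A (\<lambda>y. f (r y) \<otimes>\<^bsub>A\<^esub> x y) Y"

lemma comb_closed: "r \<in> Y \<rightarrow> carrier R \<Longrightarrow> comb r \<in> carrier A"
  unfolding comb_def by (intro f.S.finsum_closed) (auto simp: Pi_iff Y_carrier)

lemma comb_dual_closed: "r \<in> Y \<rightarrow> carrier R \<Longrightarrow> comb_dual r \<in> carrier A"
  unfolding comb_dual_def by (intro f.S.finsum_closed) (auto simp: Pi_iff x)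

lemma coord:
  assumes r: "r \<in> Y \<rightarrow> carrier R" and z: "z \<in> Y"
  shows "form (comb r \<otimes>\<^bsub>A\<^esub> x z) = r z"
proof -
  have "comb r \<otimes>\<^bsub>A\<^esub> x z = finsum A (\<lambda>y. y \<otimes>\<^bsub>A\<^esub> f (r y) \<otimes>\<^bsub>A\<^esub> x z) Y"
    unfolding comb_def using r z Y x by (intro f.S.finsum_ldistr) (auto simp: Pi_iff Y_carrier)
  also have "form \<dots> = finsum R (\<lambda>y. form (y \<otimes>\<^bsub>A\<^esub> f (r y) \<otimes>\<^bsub>A\<^esub> x z)) Y"
    using r z Y x by (intro form_finsum) (auto simp: Pi_iff Y_carrier)
  also have "\<dots> = finsum R (\<lambda>y. if z = y then r y else \<zero>) Y"
  proof (rule finsum_cong')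
    fix y assume y: "y \<in> Y"
    have "y \<otimes>\<^bsub>A\<^esub> f (r y) \<otimes>\<^bsub>A\<^esub> x z = f (r y) \<otimes>\<^bsub>A\<^esub> (y \<otimes>\<^bsub>A\<^esub> x z)"
      using scalar_pull[of "r y" y "x z"] y r z by (simp add: f.S.m_assoc Pi_iff Y_carrier x)
    then show "form (y \<otimes>\<^bsub>A\<^esub> f (r y) \<otimes>\<^bsub>A\<^esub> x z) = (if z = y then r y else \<zero>)"
      using y r z by (simp add: form_scale dual Pi_iff Y_carrier x)
  qed (use r in auto)
  also have "\<dots> = r z" using z Y r by (intro finsum_singleton) (auto simp: Pi_iff)
  finally show ?thesis .
qed

lemma coord_dual:
  assumes r: "r \<in> Y \<rightarrow> carrier R" and z: "z \<in> Y"
  shows "form (z \<otimes>\<^bsub>A\<^esub> comb_dual r) = r z"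
proof -
  have "z \<otimes>\<^bsub>A\<^esub> comb_dual r = finsum A (\<lambda>y. z \<otimes>\<^bsub>A\<^esub> (f (r y) \<otimes>\<^bsub>A\<^esub> x y)) Y"
    unfolding comb_dual_def using r z Y x by (intro f.S.finsum_rdistr) (auto simp: Pi_iff Y_carrier)
  also have "form \<dots> = finsum R (\<lambda>y. form (z \<otimes>\<^bsub>A\<^esub> (f (r y) \<otimes>\<^bsub>A\<^esub> x y))) Y"
    using r z Y x by (intro form_finsum) (auto simp: Pi_iff Y_carrier)
  also have "\<dots> = finsum R (\<lambda>y. if z = y then r y else \<zero>) Y"
  proof (rule finsum_cong')
    fix y assume y: "y \<in> Y"
    show "form (z \<otimes>\<^bsub>A\<^esub> (f (r y) \<otimes>\<^bsub>A\<^esub> x y)) = (if z = y then r y else \<zero>)"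
      using scalar_pull[of "r y" z "x y"] y r z
      by (auto simp: form_scale dual Pi_iff Y_carrier x)
  qed (use r in auto)
  also have "\<dots> = r z" using z Y r by (intro finsum_singleton) (auto simp: Pi_iff)
  finally show ?thesis .
qed

lemma expand:
  assumes a: "a \<in> carrier A"
  shows "a = comb (\<lambda>y. form (a \<otimes>\<^bsub>A\<^esub> x y))"
proof -
  let ?r = "\<lambda>y. form (a \<otimes>\<^bsub>A\<^esub> x y)"
  have r: "?r \<in> Y \<rightarrow> carrier R" using a x by (auto intro!: form_closed simp: Y_carrier)
  have "a \<ominus>\<^bsub>A\<^esub> comb ?r = \<zero>\<^bsub>A\<^esub>"
  proof (rule nondeg_left)
    fix y assume y: "y \<in> Y"
    have "(a \<ominus>\<^bsub>A\<^esub> comb ?r) \<otimes>\<^bsub>A\<^esub> x y = a \<otimes>\<^bsub>A\<^esub> x y \<ominus>\<^bsub>A\<^esub> comb ?r \<otimes>\<^bsub>A\<^esub> x y"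
      using a comb_closed[OF r] x[OF y] by (simp add: f.S.minus_eq f.S.l_distr f.S.l_minus)
    then show "form ((a \<ominus>\<^bsub>A\<^esub> comb ?r) \<otimes>\<^bsub>A\<^esub> x y) = \<zero>"
      using a comb_closed[OF r] x[OF y] coord[OF r y]
      by (simp add: form_minus form_closed minus_eq r_neg)
  qed (use a comb_closed[OF r] in simp)
  then show ?thesis using a comb_closed[OF r] f.S.r_right_minus_eq by blast
qed

lemma expand_dual:
  assumes a: "a \<in> carrier A"
  shows "a = comb_dual (\<lambda>y. form (y \<otimes>\<^bsub>A\<^esub> a))"
proof -
  let ?r = "\<lambda>y. form (y \<otimes>\<^bsub>A\<^esub> a)"
  have r: "?r \<in> Y \<rightarrow> carrier R" using a by (auto intro!: form_closed simp: Y_carrier)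
  have "a \<ominus>\<^bsub>A\<^esub> comb_dual ?r = \<zero>\<^bsub>A\<^esub>"
  proof (rule nondeg_right)
    fix y assume y: "y \<in> Y"
    have "y \<otimes>\<^bsub>A\<^esub> (a \<ominus>\<^bsub>A\<^esub> comb_dual ?r) = y \<otimes>\<^bsub>A\<^esub> a \<ominus>\<^bsub>A\<^esub> y \<otimes>\<^bsub>A\<^esub> comb_dual ?r"
      using a comb_dual_closed[OF r] Y_carrier[OF y]
      by (simp add: f.S.minus_eq f.S.r_distr f.S.r_minus)
    then show "form (y \<otimes>\<^bsub>A\<^esub> (a \<ominus>\<^bsub>A\<^esub> comb_dual ?r)) = \<zero>"
      using a comb_dual_closed[OF r] Y_carrier[OF y] coord_dual[OF r y]
      by (simp add: form_minus form_closed minus_eq r_neg)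
  qed (use a comb_dual_closed[OF r] in simp)
  then show ?thesis using a comb_dual_closed[OF r] f.S.r_right_minus_eq by blast
qed

text \<open>
  Every functional is a translate of \<open>form\<close>: both sides agree on the elements \<open>x y\<close>, and
  these span \<open>A\<close>.
\<close>

lemma functional_eq_translate:
  assumes h: "is_functional h" and b: "b \<in> carrier A"
  shows "form (comb (\<lambda>y. h (x y)) \<otimes>\<^bsub>A\<^esub> b) = h b"
proof -
  let ?a = "comb (\<lambda>y. h (x y))"
  let ?h' = "\<lambda>b. form (?a \<otimes>\<^bsub>A\<^esub> b)"
  let ?s = "\<lambda>y. form (y \<otimes>\<^bsub>A\<^esub> b)"
  let ?g = "\<lambda>y. f (?s y) \<otimes>\<^bsub>A\<^esub> x y"
  have r: "(\<lambda>y. h (x y)) \<in> Y \<rightarrow> carrier R" using h x by (auto simp: is_functional_def)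
  have h': "is_functional ?h'" by (intro form_translate_functional comb_closed r)
  have s: "?s y \<in> carrier R" if "y \<in> Y" for y using b that by (auto intro!: form_closed simp: Y_carrier)
  have g: "?g \<in> Y \<rightarrow> carrier A" using s x by auto
  have on_g: "h'' (?g y) = h'' (x y) \<otimes> ?s y" if "is_functional h''" "y \<in> Y" for h'' y
    using that(1) central[OF s x] s[OF that(2)] x[OF that(2)] that(2) by (auto simp: is_functional_def)
  have b': "b = finsum A ?g Y" using expand_dual[OF b] unfolding comb_dual_def .
  have "?h' (finsum A ?g Y) = finsum R (\<lambda>y. ?h' (?g y)) Y"
    by (rule functional_finsum[OF h' Y(1) g])
  also have "\<dots> = finsum R (\<lambda>y. h (?g y)) Y"
  proof (rule finsum_cong')
    fix y assume y: "y \<in> Y"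
    show "?h' (?g y) = h (?g y)"
      using on_g[OF h y] on_g[OF h' y] coord[OF r y] by simp
  qed (use h g in \<open>auto simp: is_functional_def Pi_iff\<close>)
  also have "\<dots> = h (finsum A ?g Y)" by (rule functional_finsum[OF h Y(1) g, symmetric])
  finally show ?thesis by (simp flip: b')
qed

lemma finitely_generated: "finitely_generated R (ext_rmodule A f)"
  unfolding finitely_generated_def
proof (intro exI[of _ Y] conjI allI impI)
  show "Y \<subseteq> carrier (ext_rmodule A f)" using Y by (simp add: ext_rmodule_def)
  fix N assume N: "rsubmodule N R (ext_rmodule A f) \<and> Y \<subseteq> N"
  then have sub: "subgroup N (add_monoid A)"
    and act: "\<And>a r. a \<in> N \<Longrightarrow> r \<in> carrier R \<Longrightarrow> a \<otimes>\<^bsub>A\<^esub> f r \<in> N"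
    by (simp_all add: rsubmodule_def ext_rmodule_def subgroup_def m_inv_def)
  have NA: "N \<subseteq> carrier A" using subgroup.subset[OF sub] by simp
  have fin: "finsum A g S \<in> N" if "finite S" "\<And>i. i \<in> S \<Longrightarrow> g i \<in> N" for g :: "'c \<Rightarrow> 'c" and S
    using that
  proof (induction S rule: finite_induct)
    case empty
    show ?case using subgroup.one_closed[OF sub] by simp
  next
    case (insert i S)
    have "finsum A g (insert i S) = g i \<oplus>\<^bsub>A\<^esub> finsum A g S"
      using insert NA by (intro f.S.finsum_insert) (auto simp: Pi_iff)
    then show ?case using insert subgroup.m_closed[OF sub, of "g i" "finsum A g S"] by simp
  qed
  show "N = carrier (ext_rmodule A f)"
  proof
    show "carrier (ext_rmodule A f) \<subseteq> N"
    proof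
      fix a assume "a \<in> carrier (ext_rmodule A f)"
      then have a: "a \<in> carrier A" by (simp add: ext_rmodule_def)
      have "comb (\<lambda>y. form (a \<otimes>\<^bsub>A\<^esub> x y)) \<in> N"
        unfolding comb_def using N a x Y by (intro fin act) (auto intro!: form_closed simp: Y_carrier)
      then show "a \<in> N" using expand[OF a] by simp
    qed
  qed (use NA in \<open>simp add: ext_rmodule_def\<close>)
qed (fact Y)

text \<open>
  The coordinates \<open>form (a (x y))\<close> identify \<open>A\<close> with the free module on \<open>Y\<close>.
\<close>

lemma projective: "projective R (ext_rmodule A f)"
proof -
  let ?F = "free_rmodule R Y"
  have carF: "carrier ?F = Y \<rightarrow>\<^sub>E carrier R" using Y by (auto simp: free_rmodule_def)
  have "comm_group (add_monoid ?F)"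
  proof (rule comm_groupI)
    fix v assume v: "v \<in> carrier (add_monoid ?F)"
    then have "v \<in> Y \<rightarrow>\<^sub>E carrier R" by (simp add: carF)
    then show "\<exists>w\<in>carrier (add_monoid ?F). w \<otimes>\<^bsub>add_monoid ?F\<^esub> v = \<one>\<^bsub>add_monoid ?F\<^esub>"
      using Y by (intro bexI[of _ "\<lambda>i\<in>Y. \<ominus> v i"])
        (auto simp: free_rmodule_def PiE_iff l_neg intro!: restrict_ext)
  next
    fix u v w assume "u \<in> carrier (add_monoid ?F)" "v \<in> carrier (add_monoid ?F)" "w \<in> carrier (add_monoid ?F)"
    then have "u \<in> Y \<rightarrow>\<^sub>E carrier R" "v \<in> Y \<rightarrow>\<^sub>E carrier R" "w \<in> Y \<rightarrow>\<^sub>E carrier R" by (simp_all add: carF)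
    then show "u \<otimes>\<^bsub>add_monoid ?F\<^esub> v \<otimes>\<^bsub>add_monoid ?F\<^esub> w
        = u \<otimes>\<^bsub>add_monoid ?F\<^esub> (v \<otimes>\<^bsub>add_monoid ?F\<^esub> w)"
      by (auto simp: free_rmodule_def intro!: restrict_ext a_assoc)
  next
    fix u v assume "u \<in> carrier (add_monoid ?F)" "v \<in> carrier (add_monoid ?F)"
    then have uv: "u \<in> Y \<rightarrow>\<^sub>E carrier R" "v \<in> Y \<rightarrow>\<^sub>E carrier R" by (simp_all add: carF)
    then have "(\<lambda>i\<in>Y. u i \<oplus> v i) \<in> Y \<rightarrow>\<^sub>E carrier R" by auto
    then show "u \<otimes>\<^bsub>add_monoid ?F\<^esub> v \<in> carrier (add_monoid ?F)"
      using carF by (simp add: free_rmodule_def)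
    show "u \<otimes>\<^bsub>add_monoid ?F\<^esub> v = v \<otimes>\<^bsub>add_monoid ?F\<^esub> u"
      using uv by (auto simp: free_rmodule_def intro!: restrict_ext a_comm)
  next
    fix u assume "u \<in> carrier (add_monoid ?F)"
    then have u: "u \<in> Y \<rightarrow>\<^sub>E carrier R" by (simp add: carF)
    have "(\<lambda>i\<in>Y. \<zero> \<oplus> u i) = u" using u by (intro extensionalityI[of _ Y]) (auto simp: PiE_iff)
    moreover have "(\<lambda>i\<in>Y. (\<lambda>i\<in>Y. \<zero>) i \<oplus> u i) = (\<lambda>i\<in>Y. \<zero> \<oplus> u i)" by (rule restrict_ext) simp
    ultimately show "\<one>\<^bsub>add_monoid ?F\<^esub> \<otimes>\<^bsub>add_monoid ?F\<^esub> u = u" by (simp add: free_rmodule_def)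
  qed (simp add: free_rmodule_def)
  then interpret F: comm_group "add_monoid ?F" .
  have right: "right_module R (ext_rmodule A f)"
  proof (intro right_module.intro right_module_axioms.intro)
    show "ring R" by (rule ring_axioms)
    show "abelian_group (ext_rmodule A f)"
      by (rule abelian_groupI) (auto simp: ext_rmodule_def f.S.a_assoc intro: f.S.a_comm f.S.l_neg)
  qed (auto simp: ext_rmodule_def f.S.l_distr f.S.r_distr f.S.m_assoc)
  have K: "rsubmodule (carrier ?F) R ?F"
    unfolding rsubmodule_def
  proof (intro conjI ballI)
    show "subgroup (carrier ?F) (add_monoid ?F)" using F.subgroup_self by simp
    fix u b assume "u \<in> carrier ?F" "b \<in> carrier R"
    then have "(\<lambda>i\<in>Y. u i \<otimes> b) \<in> Y \<rightarrow>\<^sub>E carrier R" by (auto simp: carF)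
    then show "u \<triangleleft>\<^bsub>?F\<^esub> b \<in> carrier ?F" unfolding carF by (simp add: free_rmodule_def)
  qed
  have L: "rsubmodule {\<zero>\<^bsub>?F\<^esub>} R ?F"
    unfolding rsubmodule_def
  proof (intro conjI ballI)
    show "subgroup {\<zero>\<^bsub>?F\<^esub>} (add_monoid ?F)" using F.triv_subgroup by simp
    fix u b assume "u \<in> {\<zero>\<^bsub>?F\<^esub>}" "b \<in> carrier R"
    then show "u \<triangleleft>\<^bsub>?F\<^esub> b \<in> {\<zero>\<^bsub>?F\<^esub>}" by (auto simp: free_rmodule_def intro!: restrict_ext)
  qed
  have zero: "\<zero>\<^bsub>?F\<^esub> \<in> carrier ?F" using F.one_closed by simp
  have sum: "carrier ?F <+>\<^bsub>?F\<^esub> {\<zero>\<^bsub>?F\<^esub>} = carrier ?F"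
    using F.r_one unfolding set_add_def set_mult_def by auto
  let ?h = "\<lambda>a. \<lambda>y\<in>Y. form (a \<otimes>\<^bsub>A\<^esub> x y)"
  have h: "?h \<in> rmodule_hom R (ext_rmodule A f) ?F"
    unfolding rmodule_hom_def
  proof (intro CollectI conjI ballI)
    show "?h \<in> carrier (ext_rmodule A f) \<rightarrow> carrier ?F"
      using x unfolding carF by (auto simp: ext_rmodule_def intro!: form_closed)
    fix a b assume "a \<in> carrier (ext_rmodule A f)" "b \<in> carrier (ext_rmodule A f)"
    then show "?h (a \<oplus>\<^bsub>ext_rmodule A f\<^esub> b) = ?h a \<oplus>\<^bsub>?F\<^esub> ?h b"
      using x by (auto simp: ext_rmodule_def free_rmodule_def f.S.l_distr form_add intro!: restrict_ext)
  next
    fix a r assume ar: "a \<in> carrier (ext_rmodule A f)" "r \<in> carrier R"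
    then have a: "a \<in> carrier A" by (simp add: ext_rmodule_def)
    have "form (a \<otimes>\<^bsub>A\<^esub> f r \<otimes>\<^bsub>A\<^esub> x y) = form (a \<otimes>\<^bsub>A\<^esub> x y) \<otimes> r" if "y \<in> Y" for y
      using central[OF ar(2) a, symmetric] ar a x[OF that]
      by (simp add: f.S.m_assoc form_scale form_closed m_comm)
    then show "?h (a \<triangleleft>\<^bsub>ext_rmodule A f\<^esub> r) = ?h a \<triangleleft>\<^bsub>?F\<^esub> r"
      by (auto simp: ext_rmodule_def free_rmodule_def intro!: restrict_ext)
  qed
  have bij: "bij_betw ?h (carrier A) (carrier ?F)"
  proof (rule bij_betw_byWitness[where f' = comb])
    show "\<forall>a\<in>carrier A. comb (?h a) = a"
    proof
      fix a assume a: "a \<in> carrier A"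
      have "comb (?h a) = comb (\<lambda>y. form (a \<otimes>\<^bsub>A\<^esub> x y))"
        unfolding comb_def using Y x a
          by (intro f.S.finsum_cong') (auto intro!: form_closed f.hom_closed simp: Y_carrier)
      then show "comb (?h a) = a" using expand[OF a] by simp
    qed
    show "\<forall>r\<in>carrier ?F. ?h (comb r) = r"
    proof
      fix r assume "r \<in> carrier ?F"
      then have r: "r \<in> Y \<rightarrow>\<^sub>E carrier R" by (simp add: carF)
      then have "r \<in> Y \<rightarrow> carrier R" by (auto simp: PiE_iff)
      then show "?h (comb r) = r" using coord r by (intro extensionalityI[of _ Y]) (auto simp: PiE_iff)
    qed
    show "?h ` carrier A \<subseteq> carrier ?F" using x unfolding carF by (auto intro!: form_closed simp: Y_carrier)
    show "comb ` carrier ?F \<subseteq> carrier A" unfolding carF by (auto intro!: comb_closed)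
  qed
  have "rmodule_isomorphic R (ext_rmodule A f) (?F\<lparr>carrier := carrier ?F\<rparr>)"
    unfolding rmodule_isomorphic_def using h bij by (intro bexI[of _ ?h]) (simp_all add: ext_rmodule_def)
  moreover have "carrier ?F \<inter> {\<zero>\<^bsub>?F\<^esub>} = {\<zero>\<^bsub>?F\<^esub>}" using zero by blast
  ultimately show ?thesis
    unfolding projective_def Let_def using right K L sum by blast
qed

lemma bimodule_isomorphic: "bimodule_isomorphic R A (ext_bimodule A f) (dual_bimodule R A f)"
proof -
  let ?\<Phi> = "\<lambda>a. \<lambda>b\<in>carrier A. form (a \<otimes>\<^bsub>A\<^esub> b)"
  let ?D = "dual_bimodule R A f"
  have D: "h \<in> carrier ?D \<longleftrightarrow> h \<in> extensional (carrier A) \<and> is_functional h" for h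
    by (auto simp: dual_bimodule_def rmodule_hom_def ext_rmodule_def is_functional_def)
  have closed: "?\<Phi> a \<in> carrier ?D" if "a \<in> carrier A" for a
    using form_translate_functional[OF that] unfolding D is_functional_def
    by (auto simp: Pi_iff)
  have bij: "bij_betw ?\<Phi> (carrier A) (carrier ?D)"
  proof (rule bij_betw_byWitness[where f' = "\<lambda>h. comb (\<lambda>y. h (x y))"])
    show "\<forall>a\<in>carrier A. comb (\<lambda>y. ?\<Phi> a (x y)) = a"
    proof
      fix a assume a: "a \<in> carrier A"
      have "comb (\<lambda>y. ?\<Phi> a (x y)) = comb (\<lambda>y. form (a \<otimes>\<^bsub>A\<^esub> x y))"
        unfolding comb_def using Y x a
          by (intro f.S.finsum_cong') (auto intro!: form_closed f.hom_closed simp: Y_carrier)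
      then show "comb (\<lambda>y. ?\<Phi> a (x y)) = a" using expand[OF a] by simp
    qed
    show "\<forall>h\<in>carrier ?D. ?\<Phi> (comb (\<lambda>y. h (x y))) = h"
    proof
      fix h assume "h \<in> carrier ?D"
      note h = this[unfolded D]
      show "?\<Phi> (comb (\<lambda>y. h (x y))) = h"
        using h functional_eq_translate[of h] by (intro extensionalityI[of _ "carrier A"]) auto
    qed
    show "?\<Phi> ` carrier A \<subseteq> carrier ?D" using closed by blast
    show "(\<lambda>h. comb (\<lambda>y. h (x y))) ` carrier ?D \<subseteq> carrier A"
      using x by (auto simp: D is_functional_def Pi_iff intro!: comb_closed)
  qed
  have "?\<Phi> \<in> rmodule_hom A (ext_bimodule A f) ?D"
    unfolding rmodule_hom_def
  proof (intro CollectI conjI ballI)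
    show "?\<Phi> \<in> carrier (ext_bimodule A f) \<rightarrow> carrier ?D"
      by (rule Pi_I, rule closed) (simp add: ext_bimodule_def)
    fix a b assume "a \<in> carrier (ext_bimodule A f)" "b \<in> carrier (ext_bimodule A f)"
    then show "?\<Phi> (a \<oplus>\<^bsub>ext_bimodule A f\<^esub> b) = ?\<Phi> a \<oplus>\<^bsub>?D\<^esub> ?\<Phi> b"
      by (auto simp: ext_bimodule_def dual_bimodule_def f.S.l_distr form_add intro!: restrict_ext)
  next
    fix a b assume "a \<in> carrier (ext_bimodule A f)" "b \<in> carrier A"
    then show "?\<Phi> (a \<triangleleft>\<^bsub>ext_bimodule A f\<^esub> b) = ?\<Phi> a \<triangleleft>\<^bsub>?D\<^esub> b"
      by (auto simp: ext_bimodule_def dual_bimodule_def f.S.m_assoc intro!: restrict_ext)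
  qed
  moreover have "?\<Phi> (f r \<otimes>\<^bsub>A\<^esub> a) = r \<triangleright>\<^bsub>?D\<^esub> ?\<Phi> a" if "r \<in> carrier R" "a \<in> carrier A" for r a
    using that by (auto simp: dual_bimodule_def f.S.m_assoc form_scale intro!: restrict_ext)
  ultimately show ?thesis
    unfolding bimodule_isomorphic_def using bij by (intro bexI[of _ ?\<Phi>]) (auto simp: ext_bimodule_def)
qed

theorem frobenius_algebra: "frobenius_algebra R A f"
  unfolding frobenius_algebra_def frobenius_extension_def
  using field_axioms f.ring_hom_ring_axioms central finitely_generated projective bimodule_isomorphic
  by blast

end

section \<open>Matrices as operators on finitely supported sequences\<close>

definition fscale :: "'a::field \<Rightarrow> (nat \<Rightarrow> 'a) \<Rightarrow> nat \<Rightarrow> 'a" where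
  "fscale r x = (\<lambda>i. r * x i)"

text \<open>
  Vectors of length \<open>n\<close> are realised as sequences vanishing from index \<open>n\<close> on, so that they form a
  subspace of a vector space that is a whole type.
\<close>

interpretation fvec: vector_space fscale
  by unfold_locales (auto simp: fscale_def fun_eq_iff algebra_simps)

definition vecs :: "nat \<Rightarrow> (nat \<Rightarrow> 'a::field) set" where
  "vecs n = {x. \<forall>i\<ge>n. x i = 0}"

definition unit_seq :: "nat \<Rightarrow> nat \<Rightarrow> 'a::field" where
  "unit_seq j = (\<lambda>i. if i = j then 1 else 0)"

definition mat_op :: "nat \<Rightarrow> 'a::field mat \<Rightarrow> (nat \<Rightarrow> 'a) \<Rightarrow> nat \<Rightarrow> 'a" where
  "mat_op n M x = (\<lambda>i. if i < n then \<Sum>j<n. M $$ (i, j) * x j else 0)"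

definition mat_of_op :: "nat \<Rightarrow> ((nat \<Rightarrow> 'a::field) \<Rightarrow> nat \<Rightarrow> 'a) \<Rightarrow> 'a mat" where
  "mat_of_op n F = mat n n (\<lambda>(i, j). F (unit_seq j) i)"

lemma subspace_vecs: "fvec.subspace (vecs n)"
  by (rule fvec.subspaceI) (auto simp: vecs_def fscale_def)

lemma unit_seq_in_vecs: "j < n \<Longrightarrow> unit_seq j \<in> vecs n"
  by (auto simp: vecs_def unit_seq_def)

lemma vecs_expand:
  assumes "x \<in> vecs n"
  shows "x = (\<Sum>j<n. fscale (x j) (unit_seq j))"
proof
  fix i
  have ev: "(\<Sum>j\<in>S. g j) i = (\<Sum>j\<in>S. g j i)" for S and g :: "nat \<Rightarrow> nat \<Rightarrow> 'a"
    by (induction S rule: infinite_finite_induct) simp_all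
  show "x i = (\<Sum>j<n. fscale (x j) (unit_seq j)) i"
    using assms by (auto simp: ev fscale_def unit_seq_def vecs_def if_distrib cong: if_cong)
qed

lemma vecs_independent_card:
  assumes "fvec.independent S" "S \<subseteq> vecs n"
  shows "finite S \<and> card S \<le> n"
proof -
  have "vecs n \<subseteq> fvec.span (unit_seq ` {..<n} :: (nat \<Rightarrow> 'a) set)"
  proof
    fix x :: "nat \<Rightarrow> 'a" assume "x \<in> vecs n"
    then have "x = (\<Sum>j<n. fscale (x j) (unit_seq j))" by (rule vecs_expand)
    also have "\<dots> \<in> fvec.span (unit_seq ` {..<n})"
      by (intro fvec.span_sum fvec.span_scale fvec.span_base) auto
    finally show "x \<in> fvec.span (unit_seq ` {..<n})" .
  qed
  then have "finite S \<and> card S \<le> card (unit_seq ` {..<n} :: (nat \<Rightarrow> 'a) set)"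
    using assms by (intro fvec.independent_span_bound) auto
  moreover have "card (unit_seq ` {..<n} :: (nat \<Rightarrow> 'a) set) \<le> n"
    using card_image_le[of "{..<n}" "unit_seq :: nat \<Rightarrow> nat \<Rightarrow> 'a"] by simp
  ultimately show ?thesis by simp
qed

lemma mat_op_closed: "mat_op n M x \<in> vecs n"
  by (simp add: mat_op_def vecs_def)

lemma mat_op_vec_add: "mat_op n M (x + y) = mat_op n M x + mat_op n M y"
  by (auto simp: mat_op_def fun_eq_iff algebra_simps sum.distrib)

lemma mat_op_vec_scale: "mat_op n M (fscale r x) = fscale r (mat_op n M x)"
  by (auto simp: mat_op_def fscale_def fun_eq_iff sum_distrib_left algebra_simps)

lemma mat_op_vec_0: "mat_op n M 0 = 0"
  by (simp add: mat_op_def fun_eq_iff)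

lemma mat_op_vec_sum: "mat_op n M (\<Sum>i\<in>S. g i) = (\<Sum>i\<in>S. mat_op n M (g i))"
proof (induction S rule: infinite_finite_induct)
  case (infinite S)
  then show ?case by (simp only: sum.infinite[OF infinite] mat_op_vec_0)
next
  case (insert i S)
  then show ?case by (simp only: sum.insert[OF insert.hyps] mat_op_vec_add)
qed (simp only: sum.empty mat_op_vec_0)

lemma mat_op_add:
  assumes "M \<in> carrier_mat n n" "N \<in> carrier_mat n n"
  shows "mat_op n (M + N) x = mat_op n M x + mat_op n N x"
  using assms by (auto simp: mat_op_def fun_eq_iff algebra_simps sum.distrib)

lemma mat_op_mult:
  assumes "M \<in> carrier_mat n n" "N \<in> carrier_mat n n"
  shows "mat_op n (M * N) x = mat_op n M (mat_op n N x)"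
proof
  fix i
  show "mat_op n (M * N) x i = mat_op n M (mat_op n N x) i"
  proof (cases "i < n")
    case True
    have "mat_op n (M * N) x i = (\<Sum>j<n. \<Sum>k<n. M $$ (i, k) * N $$ (k, j) * x j)"
      using assms True
      by (auto simp: mat_op_def scalar_prod_def sum_distrib_right atLeast0LessThan intro!: sum.cong)
    also have "\<dots> = (\<Sum>k<n. \<Sum>j<n. M $$ (i, k) * N $$ (k, j) * x j)" by (rule sum.swap)
    also have "\<dots> = mat_op n M (mat_op n N x) i"
      using True by (auto simp: mat_op_def sum_distrib_left mult.assoc intro!: sum.cong)
    finally show ?thesis .
  qed (simp add: mat_op_def)
qed

lemma mat_op_scalar:
  assumes "x \<in> vecs n"
  shows "mat_op n (scalar_mat n r) x = fscale r x"
proof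
  fix i
  have "scalar_mat n r $$ (i, j) * x j = (if i = j then r * x i else 0)" if "i < n" "j < n" for j
    using that by (simp add: scalar_mat_def)
  then show "mat_op n (scalar_mat n r) x i = fscale r x i"
    using assms by (simp add: mat_op_def fscale_def vecs_def)
qed

lemma mat_op_unit: "i < n \<Longrightarrow> j < n \<Longrightarrow> mat_op n M (unit_seq j) i = M $$ (i, j)"
  by (simp add: mat_op_def unit_seq_def if_distrib cong: if_cong)

lemma mat_eq_if_mat_op_eq:
  assumes "M \<in> carrier_mat n n" "N \<in> carrier_mat n n"
    and "\<And>x. x \<in> vecs n \<Longrightarrow> mat_op n M x = mat_op n N x"
  shows "M = N"
proof (rule eq_matI)
  fix i j assume "i < dim_row N" "j < dim_col N"
  then have ij: "i < n" "j < n" using assms by auto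
  then show "M $$ (i, j) = N $$ (i, j)"
    using assms(3)[OF unit_seq_in_vecs[OF ij(2)]] mat_op_unit[OF ij] by metis
qed (use assms in auto)

lemma mat_of_op_carrier [simp]: "mat_of_op n F \<in> carrier_mat n n"
  by (simp add: mat_of_op_def)

lemma mat_op_mat_of_op:
  fixes F :: "(nat \<Rightarrow> 'a::field) \<Rightarrow> nat \<Rightarrow> 'a"
  assumes F: "fvec.endomorphism_on (vecs n) F" and x: "x \<in> vecs n"
  shows "mat_op n (mat_of_op n F) x = F x"
proof -
  have F_sum: "(\<Sum>j\<in>S. g j) \<in> vecs n \<and> F (\<Sum>j\<in>S. g j) = (\<Sum>j\<in>S. F (g j))"
    if "finite S" "\<And>j. j \<in> S \<Longrightarrow> g j \<in> vecs n" for S :: "nat set" and g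
    using that
  proof (induction S rule: finite_induct)
    case empty
    have "F (fscale 0 0) = fscale 0 (F 0)"
      using F fvec.subspace_0[OF subspace_vecs, of n] unfolding fvec.endomorphism_on_def by blast
    then show ?case using fvec.subspace_0[OF subspace_vecs, of n]
      by (simp only: sum.empty fvec.scale_zero_left simp_thms)
  next
    case (insert j S)
    then have "g j \<in> vecs n" "(\<Sum>j\<in>S. g j) \<in> vecs n" "F (\<Sum>j\<in>S. g j) = (\<Sum>j\<in>S. F (g j))" by auto
    then have "g j + (\<Sum>j\<in>S. g j) \<in> vecs n" "F (g j + (\<Sum>j\<in>S. g j)) = F (g j) + (\<Sum>j\<in>S. F (g j))"
      using F fvec.subspace_add[OF subspace_vecs] unfolding fvec.endomorphism_on_def by metis+
    then show ?case by (simp only: sum.insert[OF insert.hyps] simp_thms)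
  qed
  have on_unit: "mat_op n (mat_of_op n F) (unit_seq j) = F (unit_seq j)" if "j < n" for j
  proof
    fix i
    have "F (unit_seq j) \<in> vecs n"
      using F unit_seq_in_vecs[OF that] unfolding fvec.endomorphism_on_def by blast
    then show "mat_op n (mat_of_op n F) (unit_seq j) i = F (unit_seq j) i"
      using that by (cases "i < n") (simp_all add: mat_op_unit, simp_all add: mat_of_op_def mat_op_def vecs_def)
  qed
  have unit: "(unit_seq j :: nat \<Rightarrow> 'a) \<in> vecs n" if "j < n" for j
    by (rule unit_seq_in_vecs[OF that])
  have "mat_op n (mat_of_op n F) (\<Sum>j<n. fscale (x j) (unit_seq j))
      = (\<Sum>j<n. fscale (x j) (F (unit_seq j)))"
    by (simp add: mat_op_vec_sum mat_op_vec_scale on_unit)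
  also have "\<dots> = (\<Sum>j<n. F (fscale (x j) (unit_seq j)))"
    using F unit unfolding fvec.endomorphism_on_def by (intro sum.cong) auto
  also have "\<dots> = F (\<Sum>j<n. fscale (x j) (unit_seq j))"
    using unit fvec.subspace_scale[OF subspace_vecs]
    by (intro conjunct2[OF F_sum, symmetric]) auto
  finally show ?thesis using vecs_expand[OF x] by simp
qed

lemma centralizer_mat_iff:
  assumes "c \<in> carrier_mat n n"
  shows "a \<in> centralizer_mat n c \<longleftrightarrow> a \<in> carrier_mat n n \<and>
    (\<forall>x\<in>vecs n. mat_op n a (mat_op n c x) = mat_op n c (mat_op n a x))"
proof (cases "a \<in> carrier_mat n n")
  case True
  have "a * c = c * a" if "\<forall>x\<in>vecs n. mat_op n a (mat_op n c x) = mat_op n c (mat_op n a x)"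
    using that assms True by (intro mat_eq_if_mat_op_eq[of _ n]) (auto simp: mat_op_mult)
  moreover have "mat_op n a (mat_op n c x) = mat_op n c (mat_op n a x)" if "a * c = c * a" for x
    using that mat_op_mult[OF True assms, of x] mat_op_mult[OF assms True, of x] by simp
  ultimately show ?thesis using True by (auto simp: centralizer_mat_def)
qed (simp add: centralizer_mat_def)

lemma mat_op_invariant_subspace: "invariant_subspace fscale (mat_op n c) (vecs n) n"
  by unfold_locales
    (simp_all add: mat_op_vec_add mat_op_vec_scale subspace_vecs mat_op_closed vecs_independent_card)

section \<open>Minimal matrices have a cyclic vector\<close>

text \<open>
  What commutes with \<open>a\<close> commutes with every polynomial in \<open>a\<close>.
\<close>

lemma centralizer_subset_if_polynomial:
  assumes a: "a \<in> carrier_mat n n" and c: "c \<in> carrier_mat n n"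
    and q: "\<And>x. x \<in> vecs n \<Longrightarrow> fvec.poly_act (mat_op n a) q x = mat_op n c x"
  shows "centralizer_mat n a \<subseteq> centralizer_mat n c"
proof
  fix b assume "b \<in> centralizer_mat n a"
  then have b: "b \<in> carrier_mat n n"
    and comm: "\<And>x. x \<in> vecs n \<Longrightarrow> mat_op n b (mat_op n a x) = mat_op n a (mat_op n b x)"
    by (simp_all add: centralizer_mat_iff[OF a])
  have pow: "(mat_op n a ^^ i) x \<in> vecs n \<and> mat_op n b ((mat_op n a ^^ i) x) = (mat_op n a ^^ i) (mat_op n b x)"
    if "x \<in> vecs n" for i x
    using that by (induction i) (simp_all add: mat_op_closed comm)
  have "mat_op n b (mat_op n c x) = mat_op n c (mat_op n b x)" if x: "x \<in> vecs n" for x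
  proof -
    have "mat_op n b (mat_op n c x) = mat_op n b (fvec.poly_act (mat_op n a) q x)" by (simp add: q x)
    also have "\<dots> = fvec.poly_act (mat_op n a) q (mat_op n b x)"
      using pow[OF x] by (simp add: fvec.poly_act_def mat_op_vec_sum mat_op_vec_scale)
    also have "\<dots> = mat_op n c (mat_op n b x)" by (simp add: q mat_op_closed)
    finally show ?thesis .
  qed
  then show "b \<in> centralizer_mat n c" using b by (simp add: centralizer_mat_iff[OF c])
qed

text \<open>
  Otherwise the matrix of the operator \<open>N\<close> from \<open>noncyclic_refinement\<close> would have a strictly smaller
  centralizer.  The annihilator of \<open>v\<close> then has degree below \<open>n\<close>, hence below the characteristic.
\<close>

theorem minimal_mat_imp_cyclic:
  fixes c :: "'a::field mat"
  assumes char: "CHAR('a) \<ge> n" and min: "minimal_mat n c"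
  shows "\<exists>v m \<phi>. maximal_cyclic fscale (mat_op n c) (vecs n) n v m \<phi> \<and>
    vecs n \<subseteq> range (\<lambda>p. fvec.poly_act (mat_op n c) p v)"
proof -
  have c: "c \<in> carrier_mat n n"
    and min': "\<And>a. a \<in> carrier_mat n n \<Longrightarrow> centralizer_mat n a \<subseteq> centralizer_mat n c \<Longrightarrow>
      centralizer_mat n a = centralizer_mat n c"
    using min by (auto simp: minimal_mat_def)
  interpret invariant_subspace fscale "mat_op n c" "vecs n" n by (rule mat_op_invariant_subspace)
  obtain v m where v: "v \<in> vecs n" and m: "annihilator_gen m v" "\<And>x. x \<in> vecs n \<Longrightarrow> act m x = 0"
    using ex_vector_with_minimal_polynomial by blast
  obtain \<phi> where \<phi>: "\<And>x y. \<phi> (x + y) = \<phi> x + \<phi> y" "\<And>r x. \<phi> (fscale r x) = r * \<phi> x"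
    "\<And>i. i < Polynomial.degree m \<Longrightarrow> \<phi> ((mat_op n c ^^ i) v) = (if Suc i = Polynomial.degree m then 1 else 0)"
    using ex_dual_functional[OF m(1)] by blast
  interpret maximal_cyclic fscale "mat_op n c" "vecs n" n v m \<phi>
    by unfold_locales (use v m \<phi> in auto)
  have "vecs n \<subseteq> range (\<lambda>p. act p v)"
  proof
    fix x :: "nat \<Rightarrow> 'a" assume x: "x \<in> vecs n"
    show "x \<in> range (\<lambda>p. act p v)"
    proof (rule ccontr)
      assume nx: "x \<notin> range (\<lambda>p. act p v)"
      have "Polynomial.degree m < CHAR('a)"
        using degree_annihilator_less[OF ann v x nx] char by simp
      then obtain N H q where N: "fvec.endomorphism_on (vecs n) N" and H: "fvec.endomorphism_on (vecs n) H"
        and HT: "\<And>x. x \<in> vecs n \<Longrightarrow> H (mat_op n c x) = mat_op n c (H x)"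
        and NH: "\<exists>x\<in>vecs n. N (H x) \<noteq> H (N x)"
        and q: "\<And>x. x \<in> vecs n \<Longrightarrow> fvec.poly_act N q x = mat_op n c x"
        using noncyclic_refinement[OF x nx] by blast
      define a b where "a = mat_of_op n N" and "b = mat_of_op n H"
      have ab: "a \<in> carrier_mat n n" "b \<in> carrier_mat n n" by (simp_all add: a_def b_def)
      have a_op: "mat_op n a x = N x" and b_op: "mat_op n b x = H x" if "x \<in> vecs n" for x
        using mat_op_mat_of_op N H that by (auto simp: a_def b_def)
      have "(mat_op n a ^^ i) x = (N ^^ i) x \<and> (N ^^ i) x \<in> vecs n" if "x \<in> vecs n" for i x
        using that N by (induction i) (simp_all add: a_op fvec.endomorphism_on_def)
      then have "fvec.poly_act (mat_op n a) q x = mat_op n c x" if "x \<in> vecs n" for x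
        using q[OF that] that by (simp add: fvec.poly_act_def)
      then have "centralizer_mat n a \<subseteq> centralizer_mat n c"
        by (intro centralizer_subset_if_polynomial ab c)
      then have "centralizer_mat n a = centralizer_mat n c" by (intro min' ab)
      moreover have "b \<in> centralizer_mat n c"
        using ab HT by (simp add: centralizer_mat_iff[OF c] b_op mat_op_closed)
      ultimately have "\<forall>x\<in>vecs n. mat_op n b (mat_op n a x) = mat_op n a (mat_op n b x)"
        using centralizer_mat_iff[OF ab(1)] by blast
      then have "\<forall>x\<in>vecs n. H (N x) = N (H x)"
        using N H by (simp add: a_op b_op fvec.endomorphism_on_def)
      then show False using NH by metis
    qed
  qed
  then show ?thesis using maximal_cyclic_axioms by blast
qed

section \<open>The centralizer of a cyclic matrix\<close>

lemma ring_centralizer_algebra: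
  fixes c :: "'a::field mat"
  assumes c: "c \<in> carrier_mat n n"
  shows "ring (centralizer_algebra n c)"
proof -
  interpret M: ring "ring_mat TYPE('a) n ()" by (rule ring_mat)
  have "subring (centralizer_mat n c) (ring_mat TYPE('a) n ())"
  proof (rule M.subringI)
    show "centralizer_mat n c \<subseteq> carrier (ring_mat TYPE('a) n ())"
      by (auto simp: centralizer_mat_def ring_mat_simps)
    show "\<one>\<^bsub>ring_mat TYPE('a) n ()\<^esub> \<in> centralizer_mat n c"
      using c by (simp add: centralizer_mat_def ring_mat_simps)
    fix a b assume "a \<in> centralizer_mat n c" "b \<in> centralizer_mat n c"
    then have a: "a \<in> carrier_mat n n" "a * c = c * a" and b: "b \<in> carrier_mat n n" "b * c = c * b"
      by (auto simp: centralizer_mat_def)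
    have "\<ominus>\<^bsub>ring_mat TYPE('a) n ()\<^esub> a = - a"
      using a by (intro M.minus_equality) (auto simp: ring_mat_simps)
    then show "\<ominus>\<^bsub>ring_mat TYPE('a) n ()\<^esub> a \<in> centralizer_mat n c"
      using a c by (simp add: centralizer_mat_def)
    have "a * b * c = c * (a * b)"
      using a b c assoc_mult_mat[of a n n b n c n] assoc_mult_mat[of a n n c n b n]
        assoc_mult_mat[of c n n a n b n] by simp
    then show "a \<otimes>\<^bsub>ring_mat TYPE('a) n ()\<^esub> b \<in> centralizer_mat n c"
      using a b by (simp add: centralizer_mat_def ring_mat_simps)
    have "(a + b) * c = c * (a + b)"
      using a b c by (simp add: add_mult_distrib_mat[of _ n n] mult_add_distrib_mat[of _ n n])
    then show "a \<oplus>\<^bsub>ring_mat TYPE('a) n ()\<^esub> b \<in> centralizer_mat n c"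
      using a b by (simp add: centralizer_mat_def ring_mat_simps)
  qed
  then show ?thesis unfolding centralizer_algebra_def by (rule M.subring_is_ring)
qed

lemma centralizer_algebra_simps:
  "carrier (centralizer_algebra n c) = centralizer_mat n c"
  "mult (centralizer_algebra n c) = (*)"
  "add (centralizer_algebra n c) = (+)"
  "one (centralizer_algebra n c) = 1\<^sub>m n"
  "zero (centralizer_algebra n c) = 0\<^sub>m n n"
  by (simp_all add: centralizer_algebra_def ring_mat_simps)

lemma scalar_mat_hom:
  fixes c :: "'a::field mat"
  assumes c: "c \<in> carrier_mat n n"
  shows "ring_hom_ring (ring_of_type_algebra :: 'a ring) (centralizer_algebra n c) (scalar_mat n)"
proof (rule ring_hom_ringI)
  show "ring (ring_of_type_algebra :: 'a ring)" by (rule ring_from_type_algebra)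
  show "ring (centralizer_algebra n c)" by (rule ring_centralizer_algebra[OF c])
  show "scalar_mat n r \<in> carrier (centralizer_algebra n c)" for r
    using c by (simp add: centralizer_algebra_simps centralizer_mat_def scalar_mat_def
        mult_smult_assoc_mat[of _ n n _ n] mult_smult_distrib[of _ n n _ n])
  fix r s :: 'a
  have "scalar_mat n r * scalar_mat n s = r \<cdot>\<^sub>m (s \<cdot>\<^sub>m 1\<^sub>m n)"
    by (simp add: scalar_mat_def mult_smult_assoc_mat[of _ n n _ n])
  also have "\<dots> = scalar_mat n (r * s)" by (rule eq_matI) (auto simp: scalar_mat_def)
  finally show "scalar_mat n (r \<otimes>\<^bsub>ring_of_type_algebra\<^esub> s)
      = scalar_mat n r \<otimes>\<^bsub>centralizer_algebra n c\<^esub> scalar_mat n s"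
    by (simp add: centralizer_algebra_simps ring_of_type_algebra_def)
  show "scalar_mat n (r \<oplus>\<^bsub>ring_of_type_algebra\<^esub> s)
      = scalar_mat n r \<oplus>\<^bsub>centralizer_algebra n c\<^esub> scalar_mat n s"
    by (rule eq_matI) (auto simp: centralizer_algebra_simps ring_of_type_algebra_def scalar_mat_def)
  show "scalar_mat n \<one>\<^bsub>ring_of_type_algebra\<^esub> = \<one>\<^bsub>centralizer_algebra n c\<^esub>"
    by (rule eq_matI) (auto simp: centralizer_algebra_simps ring_of_type_algebra_def scalar_mat_def)
qed

text \<open>
  A matrix commuting with \<open>c\<close> is determined by the image of the cyclic vector \<open>v\<close>, which has the form
  \<open>p(c) v\<close>; so the centralizer consists of the polynomials in \<open>c\<close>.  The form \<open>\<phi> (a v)\<close> is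
  a Frobenius form on it: the powers of \<open>c\<close> below the degree of \<open>m\<close> are a basis, and the dual basis comes from
  \<open>ex_prescribed_values\<close>.
\<close>

theorem cyclic_imp_frobenius_algebra:
  fixes c :: "'a::field mat"
  assumes c: "c \<in> carrier_mat n n"
    and cyc: "maximal_cyclic fscale (mat_op n c) (vecs n) n v m \<phi>"
    and gen: "vecs n \<subseteq> range (\<lambda>p. fvec.poly_act (mat_op n c) p v)"
  shows "frobenius_algebra (ring_of_type_algebra :: 'a ring) (centralizer_algebra n c) (scalar_mat n)"
proof -
  interpret maximal_cyclic fscale "mat_op n c" "vecs n" n v m \<phi> by (rule cyc)
  let ?d = "Polynomial.degree m"
  define pmat where "pmat p = mat_of_op n (act p)" for p
  have pmat_op: "mat_op n (pmat p) x = act p x" if "x \<in> vecs n" for p x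
    unfolding pmat_def using that
    by (intro mat_op_mat_of_op) (simp_all add: fvec.endomorphism_on_def act_closed act_vec_add act_vec_scale)
  have pmat: "pmat p \<in> centralizer_mat n c" for p
    unfolding centralizer_mat_iff[OF c]
    by (simp add: pmat_op mat_op_closed T_act) (simp add: pmat_def)
  have poly: "\<exists>p. \<forall>x\<in>vecs n. mat_op n a x = act p x" if a: "a \<in> centralizer_mat n c" for a
  proof -
    have comm: "mat_op n a (mat_op n c x) = mat_op n c (mat_op n a x)" if "x \<in> vecs n" for x
      using a that centralizer_mat_iff[OF c] by blast
    have pow: "mat_op n a ((mat_op n c ^^ i) x) = (mat_op n c ^^ i) (mat_op n a x)" if "x \<in> vecs n" for i x
      using that by (induction i) (simp_all add: comm funpow_closed)
    have a_act: "mat_op n a (act q x) = act q (mat_op n a x)" if "x \<in> vecs n" for q x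
      using pow[OF that] by (simp add: fvec.poly_act_def mat_op_vec_sum mat_op_vec_scale)
    obtain p where p: "mat_op n a v = act p v" using gen mat_op_closed by blast
    have "mat_op n a x = act p x" if x: "x \<in> vecs n" for x
    proof -
      obtain q where q: "x = act q v" using gen x by blast
      have "mat_op n a x = act q (act p v)" by (simp add: q a_act v p)
      also have "\<dots> = act p x" using act_mult[of q p v] act_mult'[of q p v] by (simp add: q)
      finally show ?thesis .
    qed
    then show ?thesis by blast
  qed
  have carrier: "a \<in> carrier_mat n n" if "a \<in> centralizer_mat n c" for a
    using that by (simp add: centralizer_mat_def)
  have eq_0: "a = 0\<^sub>m n n" if a: "a \<in> centralizer_mat n c" "mat_op n a v = 0" for a
  proof -
    obtain p where p: "\<And>x. x \<in> vecs n \<Longrightarrow> mat_op n a x = act p x" using poly a(1) by blast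
    have "act p v = 0" using p[OF v] a by simp
    then have "mat_op n a x = 0" if x: "x \<in> vecs n" for x
    proof -
      obtain q where "x = act q v" using gen x by blast
      then have "act p x = act q (act p v)" using act_mult[of q p v] act_mult'[of q p v] by simp
      then show ?thesis using p[OF x] \<open>act p v = 0\<close> by simp
    qed
    moreover have "mat_op n (0\<^sub>m n n) x = 0" for x :: "nat \<Rightarrow> 'a"
      by (simp add: mat_op_def fun_eq_iff)
    ultimately show ?thesis
      using carrier[OF a(1)] by (intro mat_eq_if_mat_op_eq[of _ n]) simp_all
  qed
  define w where "w k = (SOME p. \<forall>i<?d. \<phi> ((mat_op n c ^^ i) (act p v)) = (if i = k then 1 else 0))" for k
  have w: "\<phi> ((mat_op n c ^^ i) (act (w k) v)) = (if i = k then 1 else 0)" if "i < ?d" for k i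
    using someI_ex[OF ex_prescribed_values[of "\<lambda>i. if i = k then 1 else 0"]] that
    unfolding w_def by blast
  define b where "b i = pmat (Polynomial.monom 1 i)" for i
  have b_op: "mat_op n (b i) x = (mat_op n c ^^ i) x" if "x \<in> vecs n" for i x
    using pmat_op[OF that] by (simp add: b_def act_monom)
  have inj: "inj_on b {..<?d}"
  proof (rule inj_onI)
    fix i j assume ij: "i \<in> {..<?d}" "j \<in> {..<?d}" "b i = b j"
    have m: "act (w i) v \<in> vecs n" by (rule act_closed[OF v])
    have "(mat_op n c ^^ i) (act (w i) v) = mat_op n (b i) (act (w i) v)" by (rule b_op[OF m, symmetric])
    also have "\<dots> = mat_op n (b j) (act (w i) v)" by (simp only: ij(3))
    also have "\<dots> = (mat_op n c ^^ j) (act (w i) v)" by (rule b_op[OF m])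
    finally have "\<phi> ((mat_op n c ^^ j) (act (w i) v)) = 1" using w[of i i] ij(1) by simp
    then show "i = j" using w[of j i] ij(2) by (simp split: if_splits)
  qed
  define x where "x y = pmat (w (the_inv_into {..<?d} b y))" for y
  have x_b: "x (b i) = pmat (w i)" if "i < ?d" for i
    using the_inv_into_f_f[OF inj] that by (simp add: x_def)
  interpret K: field "ring_of_type_algebra :: 'a ring" by (rule field_from_type_algebra)
  interpret hom: ring_hom_ring "ring_of_type_algebra :: 'a ring" "centralizer_algebra n c" "scalar_mat n"
    by (rule scalar_mat_hom[OF c])
  interpret frobenius_form "ring_of_type_algebra :: 'a ring" "centralizer_algebra n c" "scalar_mat n"
    "\<lambda>a. \<phi> (mat_op n a v)" "b ` {..<?d}" x
  proof unfold_locales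
    fix r :: 'a and a assume "a \<in> carrier (centralizer_algebra n c)"
    then have a: "a \<in> carrier_mat n n" by (simp add: centralizer_algebra_simps carrier)
    show "scalar_mat n r \<otimes>\<^bsub>centralizer_algebra n c\<^esub> a = a \<otimes>\<^bsub>centralizer_algebra n c\<^esub> scalar_mat n r"
      using a by (simp add: centralizer_algebra_simps scalar_mat_def
          mult_smult_assoc_mat[of _ n n _ n] mult_smult_distrib[of _ n n _ n])
    have "scalar_mat n r \<in> carrier_mat n n" by (simp add: scalar_mat_def)
    then show "\<phi> (mat_op n (scalar_mat n r \<otimes>\<^bsub>centralizer_algebra n c\<^esub> a) v)
        = r \<otimes>\<^bsub>ring_of_type_algebra\<^esub> \<phi> (mat_op n a v)"
      using a by (simp add: centralizer_algebra_simps mat_op_mult mat_op_scalar mat_op_closed \<phi>_scale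
          ring_of_type_algebra_def)
  next
    fix y z assume "y \<in> b ` {..<?d}" "z \<in> b ` {..<?d}"
    then obtain i j where ij: "i < ?d" "y = b i" "j < ?d" "z = b j" by blast
    have "mat_op n (b i * pmat (w j)) v = (mat_op n c ^^ i) (act (w j) v)"
      using pmat carrier v by (simp add: mat_op_mult b_def pmat_op act_closed act_monom)
    then show "\<phi> (mat_op n (y \<otimes>\<^bsub>centralizer_algebra n c\<^esub> x z) v)
        = (if z = y then \<one>\<^bsub>ring_of_type_algebra\<^esub> else \<zero>\<^bsub>ring_of_type_algebra\<^esub>)"
      using ij w[of i j] inj_on_eq_iff[OF inj, of i j]
      by (auto simp: centralizer_algebra_simps ring_of_type_algebra_def x_b)
  next
    fix a assume "a \<in> carrier (centralizer_algebra n c)"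
      and z: "\<And>y. y \<in> b ` {..<?d} \<Longrightarrow>
        \<phi> (mat_op n (a \<otimes>\<^bsub>centralizer_algebra n c\<^esub> x y) v) = \<zero>\<^bsub>ring_of_type_algebra\<^esub>"
    then have a: "a \<in> centralizer_mat n c" by (simp add: centralizer_algebra_simps)
    then obtain p where p: "\<And>x. x \<in> vecs n \<Longrightarrow> mat_op n a x = act p x" using poly by blast
    let ?r = "p mod m"
    have "Polynomial.coeff ?r i = 0" if i: "i < ?d" for i
    proof -
      have "mat_op n (a * pmat (w i)) v = act ?r (act (w i) v)"
        using pmat carrier a v by (simp add: mat_op_mult pmat_op p act_closed act_mod)
      then have "0 = \<phi> (act ?r (act (w i) v))"
        using z[of "b i"] i by (simp add: centralizer_algebra_simps ring_of_type_algebra_def x_b)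
      also have "\<dots> = (\<Sum>k\<le>Polynomial.degree ?r. if k = i then Polynomial.coeff ?r k else 0)"
        unfolding \<phi>_act
      proof (rule sum.cong)
        fix k assume "k \<in> {..Polynomial.degree ?r}"
        moreover have "Polynomial.degree ?r < ?d"
          using degree_mod_less[OF m_nonzero, of p] i by auto
        ultimately show "Polynomial.coeff ?r k * \<phi> ((mat_op n c ^^ k) (act (w i) v))
            = (if k = i then Polynomial.coeff ?r k else 0)" using w[of k i] by simp
      qed simp
      also have "\<dots> = Polynomial.coeff ?r i" by (simp add: coeff_eq_0)
      finally show ?thesis by simp
    qed
    moreover have "?r = 0 \<or> Polynomial.degree ?r < ?d" using degree_mod_less[OF m_nonzero] by blast
    ultimately have "?r = 0" by (metis leading_coeff_0_iff)
    then have "mat_op n a v = 0" using p[OF v] act_mod[OF v, of p] by simp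
    then show "a = \<zero>\<^bsub>centralizer_algebra n c\<^esub>" using eq_0[OF a] by (simp add: centralizer_algebra_simps)
  next
    fix a assume "a \<in> carrier (centralizer_algebra n c)"
      and z: "\<And>y. y \<in> b ` {..<?d} \<Longrightarrow>
        \<phi> (mat_op n (y \<otimes>\<^bsub>centralizer_algebra n c\<^esub> a) v) = \<zero>\<^bsub>ring_of_type_algebra\<^esub>"
    then have a: "a \<in> centralizer_mat n c" by (simp add: centralizer_algebra_simps)
    obtain q where q: "mat_op n a v = act q v" using gen mat_op_closed by blast
    have "\<phi> ((mat_op n c ^^ i) (act q v)) = 0" if "i < ?d" for i
    proof -
      have "mat_op n (b i * a) v = (mat_op n c ^^ i) (act q v)"
        using pmat carrier a by (simp add: mat_op_mult b_def q pmat_op act_closed v act_monom)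
      then show ?thesis
        using z[of "b i"] that by (simp add: centralizer_algebra_simps ring_of_type_algebra_def)
    qed
    then have "mat_op n a v = 0" using \<phi>_nondegenerate q by simp
    then show "a = \<zero>\<^bsub>centralizer_algebra n c\<^esub>" using eq_0[OF a] by (simp add: centralizer_algebra_simps)
  qed (use pmat carrier in \<open>auto simp: centralizer_algebra_simps ring_of_type_algebra_def b_def x_def
      mat_op_add \<phi>_add\<close>)
  show ?thesis by (rule frobenius_algebra)
qed

theorem corollary1p4:
  fixes n :: nat
    and c :: "'a::field mat"
  assumes "n \<ge> 2"
    and "CHAR('a) \<ge> n"
    and "minimal_mat n c"
  shows "frobenius_algebra (ring_of_type_algebra :: 'a ring) (centralizer_algebra n c) (scalar_mat n)"
proof -
  obtain v m \<phi> where "maximal_cyclic fscale (mat_op n c) (vecs n) n v m \<phi>"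
    "vecs n \<subseteq> range (\<lambda>p. fvec.poly_act (mat_op n c) p v)"
    using minimal_mat_imp_cyclic assms by blast
  moreover have "c \<in> carrier_mat n n" using assms by (simp add: minimal_mat_def)
  ultimately show ?thesis by (intro cyclic_imp_frobenius_algebra)
qed

end
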